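(* The following decision problem is in $\mathsf{P}$ (deterministic polynomial time). Input: a prime $p$ in binary and matrices $C_1,\ldots,C_k\in \mathrm{UT}(4,p)$. Question: do there exist $Z_1,\ldots,Z_k\in \mathrm{UT}(4,p)$ with $\prod_{i=1}^k Z_i^{-1}C_iZ_i=I$?
   Context: $\mathrm{UT}(4,p)$ is the group of upper triangular $4\times 4$ matrices over $\mathbb{Z}_p=\mathbb{Z}/p\mathbb{Z}$ with all diagonal entries equal to $1$. Matrix entries are given in binary. $I$ is the identity matrix. *)

theory Defs
  imports
    "Jordan_Normal_Form.Determinant"
    "HOL-Computational_Algebra.Primes"
    "HOL-Computational_Algebra.Polynomial"
begin

section \<open>Deterministic polynomial time\<close>

text \<open>
  Deterministic multi-tape Turing machines.  States are the numbers below \<open>num_states\<close> and tape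
  symbols the numbers below \<open>num_symbols\<close>; symbol \<open>0\<close> is the blank.  The transition function maps
  the current state and the list of scanned symbols (one per tape) to the next state and, for each
  tape, the symbol to write and the head movement.
\<close>

datatype move = Move_Left | Stay | Move_Right

record tm =
  num_tapes :: nat
  num_states :: nat
  num_symbols :: nat
  start_state :: nat
  accept_state :: nat
  reject_state :: nat
  delta :: "nat \<Rightarrow> nat list \<Rightarrow> nat \<times> (nat \<times> move) list"

datatype letter = Bit bool | Sep

fun symbol_of :: "letter \<Rightarrow> nat" where
  "symbol_of (Bit False) = 1"
| "symbol_of (Bit True) = 2"
| "symbol_of Sep = 3"

definition wf_tm :: "tm \<Rightarrow> bool" where
  "wf_tm M \<longleftrightarrow>
     num_tapes M \<ge> 1 \<and> num_symbols M \<ge> 4 \<and>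
     start_state M < num_states M \<and> accept_state M < num_states M \<and>
     reject_state M < num_states M \<and> accept_state M \<noteq> reject_state M \<and>
     (\<forall>q < num_states M. \<forall>xs. length xs = num_tapes M \<and> set xs \<subseteq> {..<num_symbols M} \<longrightarrow>
        (case delta M q xs of (q', acts) \<Rightarrow>
           q' < num_states M \<and> length acts = num_tapes M \<and> fst ` set acts \<subseteq> {..<num_symbols M}))"

text \<open>A tape is infinite in both directions; it is given by its contents and the head position.\<close>

type_synonym tape = "(int \<Rightarrow> nat) \<times> int"

type_synonym config = "nat \<times> tape list"

fun scan :: "tape \<Rightarrow> nat" where
  "scan (f, h) = f h"

fun head_shift :: "move \<Rightarrow> int" where
  "head_shift Move_Left = -1"
| "head_shift Stay = 0"
| "head_shift Move_Right = 1"

fun act :: "tape \<Rightarrow> nat \<times> move \<Rightarrow> tape" where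
  "act (f, h) (a, m) = (f(h := a), h + head_shift m)"

text \<open>The accepting and the rejecting state are halting: configurations in them are fixed points.\<close>

fun tm_step :: "tm \<Rightarrow> config \<Rightarrow> config" where
  "tm_step M (q, ts) =
     (if q = accept_state M \<or> q = reject_state M then (q, ts)
      else (case delta M q (map scan ts) of (q', acts) \<Rightarrow> (q', map2 act ts acts)))"

text \<open>The input word is written on the first tape in cells \<open>0, 1, \<dots>\<close>; all other cells are blank.\<close>

definition input_tape :: "letter list \<Rightarrow> tape" where
  "input_tape w =
     (\<lambda>i. if 0 \<le> i \<and> i < int (length w) then symbol_of (w ! nat i) else 0, 0)"

definition blank_tape :: tape where
  "blank_tape = (\<lambda>_. 0, 0)"

definition init_config :: "tm \<Rightarrow> letter list \<Rightarrow> config" where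
  "init_config M w = (start_state M, input_tape w # replicate (num_tapes M - 1) blank_tape)"

definition decides_in_time :: "tm \<Rightarrow> letter list set \<Rightarrow> (nat \<Rightarrow> nat) \<Rightarrow> bool" where
  "decides_in_time M L T \<longleftrightarrow>
     (\<forall>w. \<exists>t \<le> T (length w).
        fst ((tm_step M ^^ t) (init_config M w)) = (if w \<in> L then accept_state M else reject_state M))"

definition class_P :: "letter list set set" where
  "class_P = {L. \<exists>M (f :: nat poly). wf_tm M \<and> decides_in_time M L (poly f)}"

text \<open>
  A decision problem consists of a set \<open>D\<close> of instances, an encoding of the instances as words,
  and a question \<open>Q\<close>.  It is in P if some language in P answers \<open>Q\<close> correctly on every instance.
  The solver may rely on its input being an instance; words that encode no instance may be
  accepted or rejected, but always within the polynomial time bound.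
\<close>

definition in_P :: "'a set \<Rightarrow> ('a \<Rightarrow> letter list) \<Rightarrow> ('a \<Rightarrow> bool) \<Rightarrow> bool" where
  "in_P D enc Q \<longleftrightarrow> (\<exists>L \<in> class_P. \<forall>x \<in> D. enc x \<in> L \<longleftrightarrow> Q x)"


section \<open>Unitriangular matrices over the integers modulo \<open>p\<close>\<close>

text \<open>Residue classes modulo \<open>p\<close> are represented by the integers \<open>0, \<dots>, p - 1\<close>.\<close>

definition reduce_mat :: "nat \<Rightarrow> int mat \<Rightarrow> int mat" where
  "reduce_mat p = map_mat (\<lambda>x. x mod int p)"

definition UT :: "nat \<Rightarrow> nat \<Rightarrow> int mat monoid" where
  "UT n p =
     \<lparr>carrier = {A \<in> carrier_mat n n. upper_triangular A \<and> (\<forall>i<n. A $$ (i, i) = 1) \<and>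
                   (\<forall>i<n. \<forall>j<n. A $$ (i, j) \<in> {0..<int p})},
      monoid.mult = (\<lambda>A B. reduce_mat p (A * B)),
      one = 1\<^sub>m n\<rparr>"

lemma reduce_mat_carrier [simp]: "reduce_mat p A \<in> carrier_mat n m \<longleftrightarrow> A \<in> carrier_mat n m"
  by (auto simp: reduce_mat_def)

lemma reduce_mat_mult_left:
  assumes "A \<in> carrier_mat n n" "B \<in> carrier_mat n n"
  shows "reduce_mat p (reduce_mat p A * B) = reduce_mat p (A * B)"
proof (rule eq_matI)
  fix i j assume "i < dim_row (reduce_mat p (A * B))" "j < dim_col (reduce_mat p (A * B))"
  then have ij: "i < n" "j < n"
    using assms by (auto simp: reduce_mat_def)
  have "(\<Sum>k = 0..<n. (A $$ (i, k) mod int p) * B $$ (k, j)) mod int p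
      = (\<Sum>k = 0..<n. A $$ (i, k) * B $$ (k, j)) mod int p"
    by (subst (1 2) mod_sum_eq [symmetric]) (simp add: mod_mult_left_eq)
  then show "reduce_mat p (reduce_mat p A * B) $$ (i, j) = reduce_mat p (A * B) $$ (i, j)"
    using ij assms by (simp add: reduce_mat_def scalar_prod_def)
qed (use assms in \<open>auto simp: reduce_mat_def\<close>)

lemma reduce_mat_mult_right:
  assumes "A \<in> carrier_mat n n" "B \<in> carrier_mat n n"
  shows "reduce_mat p (A * reduce_mat p B) = reduce_mat p (A * B)"
proof (rule eq_matI)
  fix i j assume "i < dim_row (reduce_mat p (A * B))" "j < dim_col (reduce_mat p (A * B))"
  then have ij: "i < n" "j < n"
    using assms by (auto simp: reduce_mat_def)
  have "(\<Sum>k = 0..<n. A $$ (i, k) * (B $$ (k, j) mod int p)) mod int p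
      = (\<Sum>k = 0..<n. A $$ (i, k) * B $$ (k, j)) mod int p"
    by (subst (1 2) mod_sum_eq [symmetric]) (simp add: mod_mult_right_eq)
  then show "reduce_mat p (A * reduce_mat p B) $$ (i, j) = reduce_mat p (A * B) $$ (i, j)"
    using ij assms by (simp add: reduce_mat_def scalar_prod_def)
qed (use assms in \<open>auto simp: reduce_mat_def\<close>)

lemma reduce_mat_id: "A \<in> carrier (UT n p) \<Longrightarrow> reduce_mat p A = A"
  by (intro eq_matI) (auto simp: UT_def reduce_mat_def)

lemma UT_carrierD: "A \<in> carrier (UT n p) \<Longrightarrow> A \<in> carrier_mat n n"
  by (simp add: UT_def)

lemma finite_carrier_UT: "finite (carrier (UT n p))"
proof (rule finite_imageD)
  let ?f = "\<lambda>A. restrict (\<lambda>ij. A $$ ij) ({..<n} \<times> {..<n})"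
  show "inj_on ?f (carrier (UT n p))"
  proof (rule inj_onI)
    fix A B assume AB: "A \<in> carrier (UT n p)" "B \<in> carrier (UT n p)" "?f A = ?f B"
    have "A $$ (i, j) = B $$ (i, j)" if "i < n" "j < n" for i j
      using fun_cong [OF AB(3), of "(i, j)"] that by simp
    then show "A = B"
      using AB(1,2) by (intro eq_matI) (auto simp: UT_def)
  qed
  have "?f ` carrier (UT n p) \<subseteq> ({..<n} \<times> {..<n}) \<rightarrow>\<^sub>E {0..<int p}"
    by (auto simp: UT_def PiE_def split: if_splits)
  then show "finite (?f ` carrier (UT n p))"
    by (rule finite_subset) (auto intro!: finite_PiE)
qed

lemma UT_mult_closed:
  assumes "p > 1" "A \<in> carrier (UT n p)" "B \<in> carrier (UT n p)"
  shows "reduce_mat p (A * B) \<in> carrier (UT n p)"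
proof -
  have low: "A $$ (i, k) * B $$ (k, j) = 0" if "j \<le> i" "i < n" "k < n" "\<not> (k = i \<and> j = i)" for i j k
  proof (cases "k < i")
    case True
    then show ?thesis using assms that by (auto simp: UT_def)
  next
    case False
    then have "j < k" using that by auto
    then have "B $$ (k, j) = 0" using assms that by (auto simp: UT_def)
    then show ?thesis by simp
  qed
  have diag: "(\<Sum>k = 0..<n. A $$ (i, k) * B $$ (k, i)) = 1" if "i < n" for i
  proof -
    have "(\<Sum>k = 0..<n. A $$ (i, k) * B $$ (k, i)) = (\<Sum>k \<in> {i}. A $$ (i, k) * B $$ (k, i))"
      by (rule sum.mono_neutral_right) (use that low in auto)
    also have "\<dots> = 1" using assms that by (auto simp: UT_def)
    finally show ?thesis .
  qed
  have off: "(\<Sum>k = 0..<n. A $$ (i, k) * B $$ (k, j)) = 0" if "j < i" "i < n" for i j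
    by (rule sum.neutral) (use that low in auto)
  have c: "A \<in> carrier_mat n n" "B \<in> carrier_mat n n"
    using assms UT_carrierD by auto
  show ?thesis
    using c diag off \<open>p > 1\<close>
    by (auto simp: UT_def reduce_mat_def scalar_prod_def intro!: upper_triangularI)
qed

lemma UT_det: "A \<in> carrier (UT n p) \<Longrightarrow> det A = 1"
  by (subst det_upper_triangular [of A n]) (auto simp: UT_def prod_list_diag_prod)

lemma UT_group:
  assumes "p > 1"
  shows "group (UT n p)"
proof (rule groupI)
  fix A B assume "A \<in> carrier (UT n p)" "B \<in> carrier (UT n p)"
  then show "A \<otimes>\<^bsub>UT n p\<^esub> B \<in> carrier (UT n p)"
    using UT_mult_closed [OF assms, of A n B] by (simp add: UT_def)
next
  show "\<one>\<^bsub>UT n p\<^esub> \<in> carrier (UT n p)"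
    using assms by (auto simp: UT_def)
next
  fix A B C
  assume "A \<in> carrier (UT n p)" "B \<in> carrier (UT n p)" "C \<in> carrier (UT n p)"
  then have c: "A \<in> carrier_mat n n" "B \<in> carrier_mat n n" "C \<in> carrier_mat n n"
    using UT_carrierD by auto
  have "reduce_mat p (reduce_mat p (A * B) * C) = reduce_mat p (A * B * C)"
    using c by (intro reduce_mat_mult_left) auto
  also have "\<dots> = reduce_mat p (A * (B * C))"
    using c by (simp add: assoc_mult_mat [of _ n n])
  also have "\<dots> = reduce_mat p (A * reduce_mat p (B * C))"
    using c by (intro reduce_mat_mult_right [symmetric]) auto
  finally show "A \<otimes>\<^bsub>UT n p\<^esub> B \<otimes>\<^bsub>UT n p\<^esub> C = A \<otimes>\<^bsub>UT n p\<^esub> (B \<otimes>\<^bsub>UT n p\<^esub> C)"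
    by (simp add: UT_def)
next
  fix A assume "A \<in> carrier (UT n p)"
  then show "\<one>\<^bsub>UT n p\<^esub> \<otimes>\<^bsub>UT n p\<^esub> A = A"
    using reduce_mat_id [of A n p] left_mult_one_mat [of A n n] by (auto simp: UT_def)
next
  fix A assume A: "A \<in> carrier (UT n p)"
  have Ac: "A \<in> carrier_mat n n" using A UT_carrierD by auto
  let ?m = "\<lambda>X. reduce_mat p (X * A)"
  have cancel: "reduce_mat p (?m X * adj_mat A) = X" if X: "X \<in> carrier (UT n p)" for X
  proof -
    have Xc: "X \<in> carrier_mat n n" using X UT_carrierD by auto
    note adj = adj_mat [OF Ac]
    have "reduce_mat p (?m X * adj_mat A) = reduce_mat p (X * A * adj_mat A)"
      using Xc Ac adj(1) by (intro reduce_mat_mult_left) auto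
    also have "X * A * adj_mat A = X * (A * adj_mat A)"
      using Xc Ac adj(1) by (simp add: assoc_mult_mat [of _ n n])
    also have "A * adj_mat A = 1\<^sub>m n"
      using adj(2) UT_det [OF A] by (auto intro!: eq_matI)
    also have "reduce_mat p (X * 1\<^sub>m n) = X"
      using Xc reduce_mat_id [OF X] by simp
    finally show ?thesis .
  qed
  have inj: "inj_on ?m (carrier (UT n p))"
    by (rule inj_on_inverseI [of _ "\<lambda>Y. reduce_mat p (Y * adj_mat A)"]) (rule cancel)
  have "?m ` carrier (UT n p) = carrier (UT n p)"
    by (rule endo_inj_surj [OF finite_carrier_UT _ inj]) (use UT_mult_closed [OF assms _ A] in auto)
  moreover have "1\<^sub>m n \<in> carrier (UT n p)"
    using assms by (auto simp: UT_def)
  ultimately obtain X where "X \<in> carrier (UT n p)" "?m X = 1\<^sub>m n"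
    by (metis (no_types, lifting) imageE)
  then show "\<exists>X \<in> carrier (UT n p). X \<otimes>\<^bsub>UT n p\<^esub> A = \<one>\<^bsub>UT n p\<^esub>"
    by (intro bexI [of _ X]) (simp_all add: UT_def)
qed


section \<open>Instances\<close>

text \<open>Binary numerals, most significant digit first and without leading zeros; \<open>0\<close> is one digit.\<close>

fun binary :: "nat \<Rightarrow> bool list" where
  "binary n = (if n < 2 then [n = 1] else binary (n div 2) @ [odd n])"

declare binary.simps [simp del]

definition encode_num :: "nat \<Rightarrow> letter list" where
  "encode_num n = map Bit (binary n) @ [Sep]"

text \<open>Matrices are listed row by row, with all their entries.\<close>

definition encode_instance :: "nat \<times> int mat list \<Rightarrow> letter list" where
  "encode_instance = (\<lambda>(p, Cs).
     concat (map encode_num (p # map nat (concat (concat (map mat_to_list Cs))))))"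

definition instances :: "(nat \<times> int mat list) set" where
  "instances = {(p, Cs). prime p \<and> set Cs \<subseteq> carrier (UT 4 p)}"

definition product_of_conjugates :: "('a, 'b) monoid_scheme \<Rightarrow> 'a list \<Rightarrow> 'a list \<Rightarrow> 'a" where
  "product_of_conjugates G Zs Cs =
     foldr (\<otimes>\<^bsub>G\<^esub>) (map2 (\<lambda>Z C. inv\<^bsub>G\<^esub> Z \<otimes>\<^bsub>G\<^esub> C \<otimes>\<^bsub>G\<^esub> Z) Zs Cs) \<one>\<^bsub>G\<^esub>"

definition spherical_solvable :: "nat \<times> int mat list \<Rightarrow> bool" where
  "spherical_solvable = (\<lambda>(p, Cs).
     \<exists>Zs. length Zs = length Cs \<and> set Zs \<subseteq> carrier (UT 4 p) \<and>
       product_of_conjugates (UT 4 p) Zs Cs = \<one>\<^bsub>UT 4 p\<^esub>)"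

end

theory Submission
  imports Defs "HOL-Library.Countable_Set" "HOL-Library.Cardinality"
begin

text \<open>
  Conjugating a matrix with superdiagonal \<open>(a, b, c)\<close>, second diagonal \<open>(d, e)\<close> and corner \<open>f\<close>
  by one with superdiagonal \<open>(x, y, z)\<close> replaces \<open>d\<close> by \<open>d + a y - b x\<close> and \<open>e\<close> by
  \<open>e + b z - c y\<close>, and moves \<open>f\<close> freely unless \<open>a = c = 0\<close> and (\<open>b \<noteq> 0\<close> or
  \<open>d = e = 0\<close>).  The superdiagonals must sum to zero.  If some \<open>b\<close> is nonzero then the second
  diagonal can be cleared; otherwise clearing it is a linear system whose rank is that of the vectors
  \<open>(a, c)\<close>.  If no factor moves the corner freely, each class with \<open>b \<noteq> 0\<close> is determined by
  \<open>b f - d e\<close>; with three or more such classes every corner value is attained, and with exactly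
  two, \<open>b\<close> and \<open>-b\<close>, one equation \<open>b (\<Sum> f) + d' e' = d e\<close> remains.

  This criterion only involves sums and products of two entries modulo \<open>p\<close>, and each product can be
  formed by Horner's scheme while one of its factors is being read, so one pass over the input
  with finitely many registers modulo \<open>p\<close> decides it.  A Turing machine keeps the registers on parallel
  tracks of one work tape and performs a register assignment by one sweep to the left and one to the right.
\<close>

section \<open>Machines over finite types\<close>

text \<open>Neither \<open>p\<close> nor the number of factors is bounded, so no search over
  conjugators is feasible. What helps is that the superdiagonal of a conjugate is fixed, which gives
  the cross terms of the product known coefficients, and that the corner entry is central, so that
  one factor able to move it settles the corner of the whole product. In the rigid case, two factors
  with total \<open>(0, 0)\<close> contribute \<open>d e\<close> and \<open>(-d)(-e)\<close>, which
  are equal; a third factor at \<open>(1, 0)\<close> makes the total of the other two nonzero and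
  their equation linear in a free coordinate. The tests need no division, since they are
  cross-multiplied with entries of the first matrix that has a nonzero entry of the relevant kind.
  When it is found, the sums over its predecessors are already in registers and can serve as
  factors; hence one pass suffices. As the time bound must also hold for words that encode no
  instance, halting is proved separately from correctness.\<close>

type_synonym ('s, 'c) machine =
  "'s \<Rightarrow> letter option \<Rightarrow> 'c option \<Rightarrow> ('s + bool) \<times> move \<times> 'c option \<times> move"

type_synonym ('s, 'c) mconfig = "('s + bool) \<times> int \<times> (int \<Rightarrow> 'c option) \<times> int"

text \<open>A state \<open>Inr b\<close> is halting, with verdict \<open>b\<close>; the input tape is read-only.\<close>

definition letter_at :: "letter list \<Rightarrow> int \<Rightarrow> letter option" where
  "letter_at w i = (if 0 \<le> i \<and> i < int (length w) then Some (w ! nat i) else None)"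

fun mstep :: "('s, 'c) machine \<Rightarrow> letter list \<Rightarrow> ('s, 'c) mconfig \<Rightarrow> ('s, 'c) mconfig" where
  "mstep \<delta> w (Inr b, i, f, h) = (Inr b, i, f, h)"
| "mstep \<delta> w (Inl s, i, f, h) = (case \<delta> s (letter_at w i) (f h) of
     (s', m, c, m') \<Rightarrow> (s', i + head_shift m, f(h := c), h + head_shift m'))"

lemma mstep_halted: "fst c = Inr b \<Longrightarrow> (mstep \<delta> w ^^ n) c = c"
  by (induction n) (cases c; auto)+

lemma mstep_halted_later:
  assumes "fst ((mstep \<delta> w ^^ t) c) = Inr b" "t \<le> t'"
  shows "fst ((mstep \<delta> w ^^ t') c) = Inr b"
proof -
  have "(mstep \<delta> w ^^ t') c = (mstep \<delta> w ^^ (t' - t)) ((mstep \<delta> w ^^ t) c)"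
    using assms(2) by (simp add: funpow_add [symmetric, THEN fun_cong, unfolded comp_def])
  then show ?thesis
    using mstep_halted [OF assms(1)] assms(1) by simp
qed

section \<open>Encoding finite machines as Turing machines\<close>

definition letter_code :: "letter option \<Rightarrow> nat" where
  "letter_code x = (case x of None \<Rightarrow> 0 | Some l \<Rightarrow> symbol_of l)"

definition cell_code :: "'c::finite option \<Rightarrow> nat" where
  "cell_code x = (case x of None \<Rightarrow> 0 | Some c \<Rightarrow> Suc (to_nat_on UNIV c))"

definition state_code :: "('s::finite + bool) \<Rightarrow> nat" where
  "state_code = to_nat_on UNIV"

lemma to_nat_on_less_card: "to_nat_on UNIV (x :: 'a::finite) < CARD('a)"
  using to_nat_on_finite [of "UNIV :: 'a set"] by (auto simp: bij_betw_def)

lemma inj_state_code: "inj (state_code :: ('s::finite + bool) \<Rightarrow> nat)"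
  using to_nat_on_finite [of "UNIV :: ('s + bool) set"] by (auto simp: bij_betw_def state_code_def)

lemma inj_cell_code: "inj (cell_code :: 'c::finite option \<Rightarrow> nat)"
  using to_nat_on_finite [of "UNIV :: 'c set"]
  by (auto simp: bij_betw_def cell_code_def inj_on_def split: option.splits)

lemma inj_letter_code: "inj letter_code"
proof (rule injI)
  fix x y assume "letter_code x = letter_code y"
  moreover have "l = l'" if "symbol_of l = symbol_of l'" for l l'
    using that by (cases l rule: symbol_of.cases; cases l' rule: symbol_of.cases) auto
  moreover have "symbol_of l > 0" for l
    by (cases l rule: symbol_of.cases) auto
  ultimately show "x = y"
    by (auto simp: letter_code_def split: option.splits) (metis less_irrefl)+
qed

lemma cell_code_less: "cell_code (x :: 'c::finite option) < Suc CARD('c)"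
  using to_nat_on_less_card by (auto simp: cell_code_def split: option.splits)

fun total_delta :: "('s, 'c) machine \<Rightarrow> 's + bool \<Rightarrow> letter option \<Rightarrow> 'c option \<Rightarrow>
    ('s + bool) \<times> move \<times> 'c option \<times> move" where
  "total_delta \<delta> (Inl s) l c = \<delta> s l c"
| "total_delta \<delta> (Inr b) l c = (Inr b, Stay, c, Stay)"

text \<open>Decoding by \<open>inv_into\<close> is arbitrary on numbers that are not codes. This is
  harmless: reachable configurations contain only codes, and every symbol written is a code or the
  scanned symbol itself. The number of symbols leaves room for the blank and three letters on one
  tape and for the blank and all cell values on the other.\<close>

definition machine_tm :: "('s::finite, 'c::finite) machine \<Rightarrow> 's \<Rightarrow> tm" where
  "machine_tm \<delta> s0 =
     \<lparr>num_tapes = 2, num_states = CARD('s + bool), num_symbols = CARD('c) + 4,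
      start_state = state_code (Inl s0 :: 's + bool),
      accept_state = state_code (Inr True :: 's + bool),
      reject_state = state_code (Inr False :: 's + bool),
      delta = (\<lambda>q xs. case total_delta \<delta> (inv_into UNIV state_code q) (inv_into UNIV letter_code (xs ! 0))
          (inv_into UNIV cell_code (xs ! 1)) of
        (s, m, c, m') \<Rightarrow> (state_code s, [(xs ! 0, m), (cell_code c, m')]))\<rparr>"

definition machine_config ::
    "letter list \<Rightarrow> ('s::finite, 'c::finite) mconfig \<Rightarrow> config" where
  "machine_config w = (\<lambda>(s, i, f, h).
     (state_code s, [(\<lambda>j. letter_code (letter_at w j), i), (\<lambda>j. cell_code (f j), h)]))"

lemma fst_machine_config: "fst (machine_config w c) = state_code (fst c)"
  by (simp add: machine_config_def split: prod.splits)

lemma wf_machine_tm: "wf_tm (machine_tm (\<delta> :: ('s::finite, 'c::finite) machine) s0)"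
proof -
  have st: "state_code s < CARD('s + bool)" for s :: "'s + bool"
    unfolding state_code_def by (rule to_nat_on_less_card)
  have cc: "cell_code x < CARD('c) + 4" for x :: "'c option"
    using cell_code_less [of x] by simp
  have "state_code (Inr True :: 's + bool) \<noteq> state_code (Inr False :: 's + bool)"
    using inj_state_code by (auto dest: injD)
  moreover have "xs ! 0 < CARD('c) + 4" if "length xs = 2" "set xs \<subseteq> {..<CARD('c) + 4}" for xs
    using that subsetD [OF that(2) nth_mem [of 0 xs]] by simp
  ultimately show ?thesis
    using st cc by (auto simp: wf_tm_def machine_tm_def split: prod.splits)
qed

lemma tm_step_machine:
  fixes \<delta> :: "('s::finite, 'c::finite) machine"
  shows "tm_step (machine_tm \<delta> s0) (machine_config w c) = machine_config w (mstep \<delta> w c)"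
proof (cases c)
  case (fields s i f h)
  have eq: "state_code s = state_code s' \<longleftrightarrow> s = s'" for s s' :: "'s + bool"
    using inj_state_code by (auto dest: injD)
  have inv: "inv_into UNIV state_code (state_code s) = s" "inv_into UNIV letter_code (letter_code l) = l"
    "inv_into UNIV cell_code (cell_code x) = x" for s :: "'s + bool" and l and x :: "'c option"
    by (simp_all add: inj_state_code inj_letter_code inj_cell_code)
  show ?thesis
    by (cases s) (auto simp: fields machine_config_def machine_tm_def eq inv fun_eq_iff
        split: prod.splits)
qed

lemma machine_init:
  fixes \<delta> :: "('s::finite, 'c::finite) machine"
  shows "init_config (machine_tm \<delta> s0) w =
    machine_config w (Inl s0, 0, (\<lambda>_. None) :: int \<Rightarrow> 'c option, 0)"
  by (auto simp: init_config_def machine_tm_def machine_config_def input_tape_def blank_tape_def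
      letter_code_def letter_at_def cell_code_def fun_eq_iff)

definition accepted :: "('s, 'c) machine \<Rightarrow> 's \<Rightarrow> letter list set" where
  "accepted \<delta> s0 = {w. \<exists>t. fst ((mstep \<delta> w ^^ t) (Inl s0, 0, \<lambda>_. None, 0)) = Inr True}"

lemma accepted_iff:
  assumes "fst ((mstep \<delta> w ^^ t) (Inl s0, 0, \<lambda>_. None, 0)) = Inr b"
  shows "w \<in> accepted \<delta> s0 \<longleftrightarrow> b"
proof
  assume "w \<in> accepted \<delta> s0"
  then obtain t' where "fst ((mstep \<delta> w ^^ t') (Inl s0, 0, \<lambda>_. None, 0)) = Inr True"
    by (auto simp: accepted_def)
  then have "Inr b = (Inr True :: 'a + bool)"
    using mstep_halted_later [OF assms, of "max t t'"]
      mstep_halted_later [of t' \<delta> w _ True "max t t'"] by fastforce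
  then show b by simp
next
  assume b
  then show "w \<in> accepted \<delta> s0" using assms by (auto simp: accepted_def)
qed

lemma accepted_in_class_P:
  fixes \<delta> :: "('s::finite, 'c::finite) machine" and f :: "nat poly"
  assumes "\<And>w. \<exists>t \<le> poly f (length w). \<exists>b.
    fst ((mstep \<delta> w ^^ t) (Inl s0, 0, \<lambda>_. None, 0)) = Inr b"
  shows "accepted \<delta> s0 \<in> class_P"
proof -
  let ?M = "machine_tm \<delta> s0"
  have run: "(tm_step ?M ^^ t) (init_config ?M w) =
      machine_config w ((mstep \<delta> w ^^ t) (Inl s0, 0, \<lambda>_. None, 0))" for t w
    by (induction t) (simp_all add: machine_init tm_step_machine)
  have "decides_in_time ?M (accepted \<delta> s0) (poly f)"
    unfolding decides_in_time_def
  proof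
    fix w
    obtain t b where t: "t \<le> poly f (length w)"
      "fst ((mstep \<delta> w ^^ t) (Inl s0, 0, \<lambda>_. None, 0)) = Inr b"
      using assms by blast
    then have "fst ((tm_step ?M ^^ t) (init_config ?M w)) =
        (if w \<in> accepted \<delta> s0 then accept_state ?M else reject_state ?M)"
      using accepted_iff [OF t(2)]
      unfolding run fst_machine_config by (cases b) (auto simp: machine_tm_def)
    with t(1) show "\<exists>t\<le>poly f (length w). fst ((tm_step ?M ^^ t) (init_config ?M w)) =
        (if w \<in> accepted \<delta> s0 then accept_state ?M else reject_state ?M)"
      by blast
  qed
  then show ?thesis
    unfolding class_P_def using wf_machine_tm by blast
qed

section \<open>Streaming machines with registers modulo p\<close>

text \<open>
  A cell of the work tape holds one bit of the modulus, one bit of each register and one bit of a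
  trial difference for each register.  The least significant bits are at the right end of the tape,
  and lists of cells start there.  An assignment sets register \<open>r\<close> to \<open>x + y + c\<close> modulo the modulus,
  where \<open>a r = (x, y, c)\<close> and \<open>None\<close> stands for zero; all registers are assigned simultaneously.
\<close>

type_synonym 'r cell = "bool \<times> ('r \<Rightarrow> bool) \<times> ('r \<Rightarrow> bool)"
type_synonym 'r assignment = "'r \<Rightarrow> 'r option \<times> 'r option \<times> bool"
type_synonym 'r observation = "'r option \<Rightarrow> 'r option \<Rightarrow> bool"

fun reg_bit :: "'r cell \<Rightarrow> 'r option \<Rightarrow> bool" where
  "reg_bit c None = False"
| "reg_bit (m, v, t) (Some r) = v r"

text \<open>The state of the leftward sweep consists of the carry of the sum \<open>u\<close> and the borrow of
  its difference with the modulus \<open>m\<close>.\<close>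

definition add_cell ::
    "'r assignment \<Rightarrow> ('r \<Rightarrow> bool \<times> bool) \<Rightarrow> 'r cell \<Rightarrow> 'r cell \<times> ('r \<Rightarrow> bool \<times> bool)" where
  "add_cell a s c =
     (let x = (\<lambda>r. reg_bit c (fst (a r)));
          y = (\<lambda>r. reg_bit c (fst (snd (a r))));
          k = (\<lambda>r. fst (s r)); b = (\<lambda>r. snd (s r)); m = fst c;
          u = (\<lambda>r. (x r \<noteq> y r) \<noteq> k r)
      in ((m, u, \<lambda>r. (u r \<noteq> m) \<noteq> b r),
          \<lambda>r. (x r \<and> y r \<or> x r \<and> k r \<or> y r \<and> k r, \<not> u r \<and> m \<or> \<not> u r \<and> b r \<or> m \<and> b r)))"

fun add_cells ::
    "'r assignment \<Rightarrow> ('r \<Rightarrow> bool \<times> bool) \<Rightarrow> 'r cell list \<Rightarrow> 'r cell list \<times> ('r \<Rightarrow> bool \<times> bool)" where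
  "add_cells a s [] = ([], s)"
| "add_cells a s (c # cs) = (let (c', s') = add_cell a s c; (cs', s'') = add_cells a s' cs
     in (c' # cs', s''))"

definition select_cell :: "('r \<Rightarrow> bool) \<Rightarrow> 'r cell \<Rightarrow> 'r cell" where
  "select_cell ch = (\<lambda>(m, v, t). (m, (\<lambda>r. if ch r then t r else v r), t))"

definition carry_in :: "'r assignment \<Rightarrow> 'r \<Rightarrow> bool \<times> bool" where
  "carry_in a r = (snd (snd (a r)), False)"

text \<open>The sum reaches the modulus exactly if it overflows the width of the tape or the
  subtraction of the modulus ends without a borrow.\<close>

definition exceeds :: "('r \<Rightarrow> bool \<times> bool) \<Rightarrow> 'r \<Rightarrow> bool" where
  "exceeds s r \<longleftrightarrow> fst (s r) \<or> \<not> snd (s r)"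

definition assign :: "'r assignment \<Rightarrow> 'r cell list \<Rightarrow> 'r cell list" where
  "assign a cs = (let (cs', s) = add_cells a (carry_in a) cs in map (select_cell (exceeds s)) cs')"

text \<open>Equality of registers is decided cell by cell, so that one bit per pair of registers
  suffices during a sweep. With \<open>None\<close> as one argument it is a test for zero.\<close>

definition observe :: "'r cell list \<Rightarrow> 'r observation" where
  "observe cs x y \<longleftrightarrow> (\<forall>c \<in> set cs. reg_bit c x = reg_bit c y)"

lemma length_add_cells [simp]: "length (fst (add_cells a s cs)) = length cs"
  by (induction cs arbitrary: s) (simp_all add: case_prod_unfold Let_def)

lemma length_assign [simp]: "length (assign a cs) = length cs"
  by (simp add: assign_def case_prod_unfold Let_def)

text \<open>\<open>Add\<close> computes sums and differences while moving left, \<open>Sel\<close> chooses between them while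
  moving right; their optional argument is an assignment that remains to be executed.  Observations
  are collected by \<open>Sel\<close>.\<close>

datatype ('q, 'r) ctl =
    Load
  | Main 'q "'r observation"
  | Add 'q "'r assignment" "'r assignment option" "'r \<Rightarrow> bool \<times> bool"
  | Sel 'q "'r assignment option" "'r \<Rightarrow> bool" "'r observation"

instance ctl :: (finite, finite) finite
proof
  let ?M = "\<lambda>(q, ob). Main q ob :: ('a, 'b) ctl"
  let ?A = "\<lambda>(q, a, k, s). Add q a k s :: ('a, 'b) ctl"
  let ?S = "\<lambda>(q, k, ch, ob). Sel q k ch ob :: ('a, 'b) ctl"
  have "x \<in> {Load} \<union> range ?M \<union> range ?A \<union> range ?S" for x
  proof (cases x)
    case (Main q ob)
    then have "x = ?M (q, ob)" by simp
    then show ?thesis by blast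
  next
    case (Add q a k s)
    then have "x = ?A (q, a, k, s)" by simp
    then show ?thesis by blast
  next
    case (Sel q k ch ob)
    then have "x = ?S (q, k, ch, ob)" by simp
    then show ?thesis by blast
  qed simp
  then have "UNIV \<subseteq> {Load} \<union> range ?M \<union> range ?A \<union> range ?S"
    by (rule subsetI)
  then show "finite (UNIV :: ('a, 'b) ctl set)"
    by (rule finite_subset) simp
qed

text \<open>\<open>ls\<close> lists the cells left of position \<open>length ls\<close> from right to left.\<close>

definition tape :: "'c list \<Rightarrow> 'c list \<Rightarrow> int \<Rightarrow> 'c option" where
  "tape ls rs i = (if 0 \<le> i \<and> i < int (length ls + length rs) then Some ((rev ls @ rs) ! nat i)
     else None)"

lemma tape_shift: "tape (x # ls) rs = tape ls (x # rs)"
  by (simp add: tape_def fun_eq_iff)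

lemma tape_write: "(tape ls (x # rs))(int (length ls) := Some y) = tape ls (y # rs)"
  by (auto simp: tape_def fun_eq_iff nth_append nth_Cons split: nat.split)

lemma tape_read: "tape ls (x # rs) (int (length ls)) = Some x"
  by (simp add: tape_def nth_append)

lemma tape_left [simp]: "tape ls rs (- 1) = None"
  by (simp add: tape_def)

lemma tape_right [simp]: "tape ls [] (int (length ls)) = None"
  by (simp add: tape_def)

declare fun_upd_idem [simp]

section \<open>Runs of the streaming machine\<close>

locale streamer =
  fixes q0 :: "'q::finite"
    and upd :: "'q \<Rightarrow> letter \<Rightarrow> 'r::finite observation \<Rightarrow> 'q \<times> 'r assignment \<times> 'r assignment"
    and fin :: "'q \<Rightarrow> 'r observation \<Rightarrow> bool"
begin

text \<open>In \<open>Main\<close> the work head stands on the rightmost, least significant cell;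
  the blanks at both ends show where a sweep turns. The observation after loading is constantly true
  because all registers are still zero. The rule for \<open>Load\<close> at the end of the input
  makes words without a separator halt.\<close>

fun ctl_step :: "(('q, 'r) ctl, 'r cell) machine" where
  "ctl_step Load (Some (Bit b)) x = (Inl Load, Move_Right, Some (b, \<lambda>_. False, \<lambda>_. False), Move_Right)"
| "ctl_step Load (Some Sep) x = (Inl (Main q0 (\<lambda>_ _. True)), Move_Right, x, Move_Left)"
| "ctl_step Load None x = (Inr False, Stay, x, Stay)"
| "ctl_step (Main q ob) (Some l) x = (case upd q l ob of
     (q', a, a') \<Rightarrow> (Inl (Add q' a (Some a') (carry_in a)), Move_Right, x, Stay))"
| "ctl_step (Main q ob) None x = (Inr (fin q ob), Stay, x, Stay)"
| "ctl_step (Add q a k s) l (Some c) = (case add_cell a s c of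
     (c', s') \<Rightarrow> (Inl (Add q a k s'), Stay, Some c', Move_Left))"
| "ctl_step (Add q a k s) l None = (Inl (Sel q k (exceeds s) (\<lambda>_ _. True)), Stay, None, Move_Right)"
| "ctl_step (Sel q k ch ob) l (Some c) =
     (Inl (Sel q k ch (\<lambda>x y. ob x y \<and> reg_bit (select_cell ch c) x = reg_bit (select_cell ch c) y)),
      Stay, Some (select_cell ch c), Move_Right)"
| "ctl_step (Sel q (Some a) ch ob) l None = (Inl (Add q a None (carry_in a)), Stay, None, Move_Left)"
| "ctl_step (Sel q None ch ob) l None = (Inl (Main q ob), Stay, None, Move_Left)"

abbreviation steps :: "letter list \<Rightarrow> nat \<Rightarrow> (('q, 'r) ctl, 'r cell) mconfig \<Rightarrow> (('q, 'r) ctl, 'r cell) mconfig" where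
  "steps w n \<equiv> mstep ctl_step w ^^ n"

lemma steps_add: "steps w m c = c' \<Longrightarrow> steps w n c' = c'' \<Longrightarrow> steps w (m + n) c = c''"
  by (simp add: add.commute [of m] funpow_add)

lemma steps_Add:
  "steps w (length ls) (Inl (Add q a k s), i, tape ls rs, int (length ls) - 1) =
     (Inl (Add q a k (snd (add_cells a s ls))), i, tape [] (rev (fst (add_cells a s ls)) @ rs), - 1)"
proof (induction ls arbitrary: s rs)
  case (Cons c ls)
  obtain c' s' where c': "add_cell a s c = (c', s')" by (metis surj_pair)
  have "mstep ctl_step w (Inl (Add q a k s), i, tape (c # ls) rs, int (length (c # ls)) - 1) =
      (Inl (Add q a k s'), i, tape ls (c' # rs), int (length ls) - 1)"
    by (simp add: tape_shift tape_read tape_write c')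
  then have "steps w (length (c # ls)) (Inl (Add q a k s), i, tape (c # ls) rs, int (length (c # ls)) - 1) =
      steps w (length ls) (Inl (Add q a k s'), i, tape ls (c' # rs), int (length ls) - 1)"
    by (simp only: list.size(4) add_0_right add_Suc_right funpow_Suc_right comp_apply One_nat_def plus_1_eq_Suc)
  then show ?case
    unfolding Cons.IH by (simp add: c' case_prod_unfold Let_def)
qed simp

lemma steps_Sel:
  "steps w (length rs) (Inl (Sel q k ch ob), i, tape ls rs, int (length ls)) =
     (Inl (Sel q k ch (\<lambda>x y. ob x y \<and> observe (map (select_cell ch) rs) x y)), i,
      tape (rev (map (select_cell ch) rs) @ ls) [], int (length ls + length rs))"
proof (induction rs arbitrary: ob ls)
  case (Cons c rs)
  have "mstep ctl_step w (Inl (Sel q k ch ob), i, tape ls (c # rs), int (length ls)) =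
      (Inl (Sel q k ch (\<lambda>x y. ob x y \<and> reg_bit (select_cell ch c) x = reg_bit (select_cell ch c) y)),
       i, tape (select_cell ch c # ls) rs, int (length (select_cell ch c # ls)))"
    by (simp add: tape_read tape_write tape_shift add.commute)
  then have "steps w (length (c # rs)) (Inl (Sel q k ch ob), i, tape ls (c # rs), int (length ls)) =
      steps w (length rs)
       (Inl (Sel q k ch (\<lambda>x y. ob x y \<and> reg_bit (select_cell ch c) x = reg_bit (select_cell ch c) y)),
       i, tape (select_cell ch c # ls) rs, int (length (select_cell ch c # ls)))"
    by (simp only: list.size(4) add_0_right add_Suc_right funpow_Suc_right comp_apply One_nat_def plus_1_eq_Suc)
  then show ?case
    unfolding Cons.IH by (simp add: observe_def conj_assoc)
qed (simp add: observe_def)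

text \<open>One step per cell in each direction and one for the turn at the left blank. The head
  ends on the right blank, one cell beyond where it started.\<close>

lemma steps_assign:
  fixes cs :: "'r cell list"
  shows "steps w (2 * length cs + 1) (Inl (Add q a k (carry_in a)), i, tape cs [], int (length cs) - 1) =
     (Inl (Sel q k (exceeds (snd (add_cells a (carry_in a) cs))) (observe (assign a cs))), i,
      tape (assign a cs) [], int (length cs))"
proof -
  obtain cs' s where cs': "add_cells a (carry_in a) cs = (cs', s)" by force
  then have len: "length cs' = length cs" by (metis fst_conv length_add_cells)
  have 1: "steps w (length cs) (Inl (Add q a k (carry_in a)), i, tape cs [], int (length cs) - 1) =
     (Inl (Add q a k s), i, tape [] (rev cs'), - 1)"
    using steps_Add [of cs w q a k "carry_in a" i "[]"] by (simp add: cs')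
  have 2: "steps w 1 (Inl (Add q a k s), i, tape [] (rev cs'), - 1) =
     (Inl (Sel q k (exceeds s) (\<lambda>_ _. True)), i, tape [] (rev cs'), 0)"
    by simp
  have 3: "steps w (length cs) (Inl (Sel q k (exceeds s) (\<lambda>_ _. True)), i, tape [] (rev cs'), 0) =
     (Inl (Sel q k (exceeds s) (observe (assign a cs))), i, tape (assign a cs) [], int (length cs))"
    using steps_Sel [of "rev cs'" w q k "exceeds s" "\<lambda>_ _. True" i "[]"]
    by (simp add: len rev_map assign_def cs' observe_def fun_eq_iff)
  show ?thesis
    using steps_add [OF steps_add [OF 1 2] 3] by (simp add: cs' mult_2)
qed

definition cell_step :: "letter \<Rightarrow> 'q \<times> 'r cell list \<Rightarrow> 'q \<times> 'r cell list" where
  "cell_step l = (\<lambda>(q, cs). case upd q l (observe cs) of (q', a, a') \<Rightarrow> (q', assign a' (assign a cs)))"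

fun main_config :: "int \<Rightarrow> 'q \<times> 'r cell list \<Rightarrow> (('q, 'r) ctl, 'r cell) mconfig" where
  "main_config i (q, cs) = (Inl (Main q (observe cs)), i, tape cs [], int (length cs) - 1)"

text \<open>Two assignments of \<open>2 * n + 1\<close> steps each, for \<open>n\<close> cells, and
  three more steps: reading the letter, starting the second assignment and returning to
  \<open>Main\<close>.\<close>

lemma steps_letter:
  assumes "letter_at w i = Some l"
  shows "steps w (4 * length (snd c) + 5) (main_config i c) = main_config (i + 1) (cell_step l c)"
proof -
  obtain q cs where c: "c = (q, cs)" by force
  obtain q' a a' where u: "upd q l (observe cs) = (q', a, a')" by (metis prod_cases3)
  have 1: "steps w 1 (main_config i c) =
      (Inl (Add q' a (Some a') (carry_in a)), i + 1, tape cs [], int (length cs) - 1)"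
    using assms by (simp add: c u)
  note 2 = steps_add [OF 1 steps_assign]
  let ?a = "assign a cs"
  have 3: "steps w 1 (Inl (Sel q' (Some a') ch ob), i + 1, tape ?a [], int (length cs)) =
      (Inl (Add q' a' None (carry_in a')), i + 1, tape ?a [], int (length ?a) - 1)" for ch ob
    using tape_right [of ?a] by (simp del: tape_right)
  note 4 = steps_add [OF steps_add [OF 2 3] steps_assign]
  have 5: "steps w 1 (Inl (Sel q' None ch ob), i + 1, tape (assign a' ?a) [], int (length ?a)) =
      (Inl (Main q' ob), i + 1, tape (assign a' ?a) [], int (length ?a) - 1)" for ch ob
    using tape_right [of "assign a' ?a"] by (simp del: tape_right)
  show ?thesis
    using steps_add [OF 4 5]
    by (simp add: c u cell_step_def) (simp add: algebra_simps eval_nat_numeral)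
qed

lemma length_cell_step [simp]: "length (snd (cell_step l c)) = length (snd c)"
  by (simp add: cell_step_def split: prod.splits)

lemma length_fold_cell_step [simp]: "length (snd (fold cell_step u c)) = length (snd c)"
  by (induction u arbitrary: c) simp_all

lemma steps_fold:
  assumes "w = v @ u"
  shows "steps w (length u * (4 * length (snd c) + 5)) (main_config (int (length v)) c) =
    main_config (int (length w)) (fold cell_step u c)"
  using assms
proof (induction u arbitrary: v c)
  case (Cons l u)
  have "letter_at w (int (length v)) = Some l"
    using Cons.prems by (simp add: letter_at_def)
  note 1 = steps_letter [OF this, of c]
  have "steps w (length u * (4 * length (snd c) + 5)) (main_config (int (length v) + 1) (cell_step l c)) =
      main_config (int (length w)) (fold cell_step u (cell_step l c))"
    using Cons.IH [of "v @ [l]" "cell_step l c"] Cons.prems by (simp add: add.commute)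
  note 2 = steps_add [OF 1 this]
  have eq: "length (l # u) * (4 * length (snd c) + 5) =
      4 * length (snd c) + 5 + length u * (4 * length (snd c) + 5)"
    by simp
  show ?case unfolding eq fold_simps by (rule 2)
qed simp

definition load_cells :: "bool list \<Rightarrow> 'r cell list" where
  "load_cells bs = map (\<lambda>b. (b, \<lambda>_. False, \<lambda>_. False)) (rev bs)"

lemma steps_load:
  assumes "w = map Bit bs @ u"
  shows "steps w (length bs) (Inl Load, 0, \<lambda>_. None, 0) =
    (Inl Load, int (length bs), tape (load_cells bs) [], int (length bs))"
  using assms
proof (induction bs arbitrary: u rule: rev_induct)
  case Nil
  show ?case by (simp add: tape_def fun_eq_iff load_cells_def)
next
  case (snoc b bs)
  have 1: "steps w (length bs) (Inl Load, 0, \<lambda>_. None, 0) =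
    (Inl Load, int (length bs), tape (load_cells bs) [], int (length bs))"
    using snoc.IH [of "Bit b # u"] snoc.prems by simp
  have "letter_at w (int (length bs)) = Some (Bit b)"
    using snoc.prems by (simp add: letter_at_def nth_append)
  moreover have "(tape (load_cells bs) [])(int (length bs) := Some (b, \<lambda>_. False, \<lambda>_. False)) =
      tape (load_cells (bs @ [b])) []"
    by (auto simp: tape_def load_cells_def fun_eq_iff nth_append)
  ultimately have 2: "steps w 1 (Inl Load, int (length bs), tape (load_cells bs) [], int (length bs)) =
      (Inl Load, int (length (bs @ [b])), tape (load_cells (bs @ [b])) [], int (length (bs @ [b])))"
    by (simp add: add.commute)
  from steps_add [OF 1 2] show ?case by simp
qed

lemma observe_load_cells: "observe (load_cells bs) = (\<lambda>_ _. True)"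
proof -
  have "reg_bit (b, \<lambda>_. False, t) x = False" for b t and x :: "'r option"
    by (cases x) auto
  then show ?thesis by (auto simp: observe_def load_cells_def fun_eq_iff)
qed

definition verdict :: "'q \<times> 'r cell list \<Rightarrow> bool" where
  "verdict c \<longleftrightarrow> fin (fst c) (observe (snd c))"

lemma steps_total:
  assumes w: "w = map Bit bs @ Sep # u"
  shows "fst (steps w (length bs + 2 + length u * (4 * length bs + 5)) (Inl Load, 0, \<lambda>_. None, 0)) =
    Inr (verdict (fold cell_step u (q0, load_cells bs)))"
proof -
  let ?c = "fold cell_step u (q0, load_cells bs)"
  note 1 = steps_load [OF w]
  have len: "length (load_cells bs) = length bs"
    by (simp add: load_cells_def)
  have "letter_at w (int (length bs)) = Some Sep"
    using w by (simp add: letter_at_def nth_append)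
  then have 2: "steps w 1 (Inl Load, int (length bs), tape (load_cells bs) [], int (length bs)) =
      main_config (int (length (map Bit bs @ [Sep]))) (q0, load_cells bs)"
    using len by (simp add: observe_load_cells add.commute)
  have "w = (map Bit bs @ [Sep]) @ u"
    using w by simp
  note 3 = steps_add [OF steps_add [OF 1 2] steps_fold [OF this]]
  have "letter_at w (int (length w)) = None"
    by (simp add: letter_at_def)
  then have 4: "fst (steps w 1 (main_config (int (length w)) ?c)) = Inr (verdict ?c)"
    by (cases ?c) (simp add: verdict_def)
  have eq: "length bs + 2 + length u * (4 * length bs + 5) =
      length bs + 1 + length u * (4 * length (snd (q0, load_cells bs)) + 5) + 1"
    by (simp add: len)
  show ?thesis
    unfolding eq by (subst steps_add [OF 3 refl]) (rule 4)
qed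

lemma steps_incomplete:
  "fst (steps (map Bit bs) (length bs + 1) (Inl Load, 0, \<lambda>_. None, 0)) = Inr False"
proof -
  let ?w = "map Bit bs"
  have 1: "steps ?w (length bs) (Inl Load, 0, \<lambda>_. None, 0) =
      (Inl Load, int (length bs), tape (load_cells bs) [], int (length bs))"
    by (rule steps_load [of _ _ "[]"]) simp
  have "letter_at ?w (int (length bs)) = None"
    by (simp add: letter_at_def)
  then have 2: "fst (steps ?w 1 (Inl Load, int (length bs), tape (load_cells bs) [], int (length bs))) =
      Inr False"
    by simp
  show ?thesis
    by (subst steps_add [OF 1 refl]) (rule 2)
qed

lemma letters_cases:
  obtains bs where "w = map Bit bs" | bs u where "w = map Bit bs @ Sep # u"
proof (induction w arbitrary: thesis)
  case (Cons l w)
  show ?case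
  proof (cases l)
    case (Bit b)
    show ?thesis
    proof (rule Cons.IH)
      fix bs assume "w = map Bit bs"
      then show thesis using Cons.prems(1) [of "b # bs"] Bit by simp
    next
      fix bs u assume "w = map Bit bs @ Sep # u"
      then show thesis using Cons.prems(2) [of "b # bs" u] Bit by simp
    qed
  next
    case Sep
    then show ?thesis using Cons.prems(2) [of "[]" w] by simp
  qed
qed simp

theorem accepted_streamer_in_class_P: "accepted ctl_step Load \<in> class_P"
proof (rule accepted_in_class_P)
  fix w :: "letter list"
  let ?n = "length w"
  \<comment> \<open>Loading, the separator and the end of the input cost at most
    \<open>2 + n\<close> steps. The tape has at most \<open>n\<close> cells, so each of at most
    \<open>n\<close> letters costs at most \<open>4 * n + 5\<close>.\<close>
  have poly: "poly [:2, 6, 4:] ?n = 2 + ?n + ?n * (4 * ?n + 5)"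
    by (simp add: algebra_simps)
  show "\<exists>t\<le>poly [:2, 6, 4:] ?n. \<exists>b. fst (steps w t (Inl Load, 0, \<lambda>_. None, 0)) = Inr b"
  proof (cases w rule: letters_cases)
    case (1 bs)
    have "?n + 1 \<le> 2 + ?n + ?n * (4 * ?n + 5)" by simp
    then show ?thesis
      using steps_incomplete [of bs] 1 poly by (metis length_map)
  next
    case (2 bs u)
    have "length u * (4 * length bs + 5) \<le> ?n * (4 * ?n + 5)"
      by (rule mult_le_mono) (auto simp: 2)
    then have "length bs + 2 + length u * (4 * length bs + 5) \<le> poly [:2, 6, 4:] ?n"
      unfolding poly using 2 by simp
    then show ?thesis
      using steps_total [OF 2] by blast
  qed
qed

theorem accepted_streamer_iff:
  "map Bit bs @ Sep # u \<in> accepted ctl_step Load \<longleftrightarrow>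
    verdict (fold cell_step u (q0, load_cells bs))"
  by (rule accepted_iff [OF steps_total [OF refl]])

end

section \<open>Tracks of the tape as binary numerals\<close>

fun weight :: "('c \<Rightarrow> bool) \<Rightarrow> 'c list \<Rightarrow> nat" where
  "weight f [] = 0"
| "weight f (c # cs) = of_bool (f c) + 2 * weight f cs"

lemma weight_less: "weight f cs < 2 ^ length cs"
  by (induction cs) auto

text \<open>Binary digits of a fixed length are unique. This turns the cellwise comparison of
  \<open>observe\<close> into equality of numbers.\<close>

lemma weight_eq_iff: "weight f cs = weight g cs \<longleftrightarrow> (\<forall>c \<in> set cs. f c = g c)"
proof (induction cs)
  case (Cons c cs)
  have "of_bool a + 2 * m = of_bool b + 2 * n \<longleftrightarrow> a = b \<and> m = n" for a b and m n :: nat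
    by (cases a; cases b) (auto, presburger+)
  then show ?case using Cons by auto
qed simp

lemma weight_map: "weight f (map h cs) = weight (f \<circ> h) cs"
  by (induction cs) auto

lemma weight_cong: "(\<And>c. c \<in> set cs \<Longrightarrow> f c = g c) \<Longrightarrow> weight f cs = weight g cs"
  by (simp add: weight_eq_iff)

lemma weight_False: "weight (\<lambda>_. False) cs = 0"
  by (induction cs) auto

fun reg_val :: "('r \<Rightarrow> nat) \<Rightarrow> 'r option \<Rightarrow> nat" where
  "reg_val \<rho> None = 0"
| "reg_val \<rho> (Some r) = \<rho> r"

definition assign_mod :: "nat \<Rightarrow> 'r assignment \<Rightarrow> ('r \<Rightarrow> nat) \<Rightarrow> 'r \<Rightarrow> nat" where
  "assign_mod p a \<rho> r = (reg_val \<rho> (fst (a r)) + reg_val \<rho> (fst (snd (a r))) + of_bool (snd (snd (a r)))) mod p"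

definition represents :: "nat \<Rightarrow> ('r \<Rightarrow> nat) \<Rightarrow> 'r cell list \<Rightarrow> bool" where
  "represents p \<rho> cs \<longleftrightarrow> weight fst cs = p \<and> (\<forall>r. weight (\<lambda>c. fst (snd c) r) cs = \<rho> r \<and> \<rho> r < p)"

lemma weight_reg_bit: "represents p \<rho> cs \<Longrightarrow> weight (\<lambda>c. reg_bit c x) cs = reg_val \<rho> x"
proof (cases x)
  case (Some r)
  have "reg_bit c (Some r) = fst (snd c) r" for c
    by (cases c) auto
  then show "represents p \<rho> cs \<Longrightarrow> ?thesis" by (simp add: represents_def Some)
qed (simp add: weight_False)

lemma observe_eq:
  assumes "represents p \<rho> cs"
  shows "observe cs x y \<longleftrightarrow> reg_val \<rho> x = reg_val \<rho> y"
  using weight_reg_bit [OF assms, of x] weight_reg_bit [OF assms, of y]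
  by (auto simp: observe_def simp flip: weight_eq_iff)

lemma add_cells_modulus: "weight fst (fst (add_cells a s cs)) = weight fst cs"
  by (induction cs arbitrary: s) (simp_all add: case_prod_unfold Let_def add_cell_def)

text \<open>Each cell satisfies the full adder identity
  \<open>u + 2 * carry' = x + y + carry\<close>; in the weighted sum the last carry gets the weight
  \<open>2 ^ length cs\<close>.\<close>

lemma add_cells_sum:
  "weight (\<lambda>c. fst (snd c) r) (fst (add_cells a s cs)) +
     2 ^ length cs * of_bool (fst (snd (add_cells a s cs) r)) =
   weight (\<lambda>c. reg_bit c (fst (a r))) cs + weight (\<lambda>c. reg_bit c (fst (snd (a r)))) cs +
     of_bool (fst (s r))"
proof (induction cs arbitrary: s)
  case (Cons c cs)
  let ?s = "snd (add_cell a s c)"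
  have "of_bool (fst (snd (fst (add_cell a s c))) r) + 2 * of_bool (fst (?s r)) =
      of_bool (reg_bit c (fst (a r))) + of_bool (reg_bit c (fst (snd (a r)))) + (of_bool (fst (s r)) :: nat)"
    by (simp add: add_cell_def Let_def)
  then show ?case
    using Cons.IH [of ?s] by (simp add: case_prod_unfold Let_def algebra_simps)
qed simp

text \<open>The full subtractor identity \<open>t + m + borrow = u + 2 * borrow'\<close> of each
  cell, arranged so that natural numbers are only added.\<close>

lemma add_cells_difference:
  "weight (\<lambda>c. snd (snd c) r) (fst (add_cells a s cs)) + weight fst cs + of_bool (snd (s r)) =
   weight (\<lambda>c. fst (snd c) r) (fst (add_cells a s cs)) +
     2 ^ length cs * of_bool (snd (snd (add_cells a s cs) r))"
proof (induction cs arbitrary: s)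
  case (Cons c cs)
  let ?s = "snd (add_cell a s c)"
  have "of_bool (snd (snd (fst (add_cell a s c))) r) + of_bool (fst c) + of_bool (snd (s r)) =
      of_bool (fst (snd (fst (add_cell a s c))) r) + 2 * (of_bool (snd (?s r)) :: nat)"
    by (simp add: add_cell_def Let_def)
  then show ?case
    using Cons.IH [of ?s] by (simp add: case_prod_unfold Let_def algebra_simps)
qed simp

text \<open>Two residues and a carry sum to less than \<open>2 * p\<close>, so one conditional
  subtraction of the modulus reduces the sum.\<close>

lemma represents_assign:
  assumes rep: "represents p \<rho> cs"
  shows "represents p (assign_mod p a \<rho>) (assign a cs)"
proof -
  define s where "s = snd (add_cells a (carry_in a) cs)"
  define cs' where "cs' = fst (add_cells a (carry_in a) cs)"
  have as: "assign a cs = map (select_cell (exceeds s)) cs'"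
    by (simp add: assign_def s_def cs'_def case_prod_unfold Let_def)
  have "weight fst (assign a cs) = weight fst cs'"
    unfolding as weight_map by (rule weight_cong) (simp add: select_cell_def case_prod_unfold)
  also have "\<dots> = p"
    using rep by (simp add: cs'_def add_cells_modulus represents_def)
  finally have modulus: "weight fst (assign a cs) = p" .
  have "weight (\<lambda>c. fst (snd c) r) (assign a cs) = assign_mod p a \<rho> r \<and> assign_mod p a \<rho> r < p" for r
  proof -
    let ?X = "reg_val \<rho> (fst (a r)) + reg_val \<rho> (fst (snd (a r))) + of_bool (snd (snd (a r)))"
    let ?u = "weight (\<lambda>c. fst (snd c) r) cs'" and ?t = "weight (\<lambda>c. snd (snd c) r) cs'"
    let ?N = "2 ^ length cs :: nat"
    have p: "0 < p" "p < ?N"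
      using rep weight_less [of fst cs] by (auto simp: represents_def)
    have lt: "reg_val \<rho> x < p" for x
      using rep p by (cases x) (auto simp: represents_def)
    have X: "?X < 2 * p"
      using lt [of "fst (a r)"] lt [of "fst (snd (a r))"] by auto
    have 1: "?u + ?N * of_bool (fst (s r)) = ?X"
      using add_cells_sum [of r a "carry_in a" cs]
      by (simp add: weight_reg_bit [OF rep] carry_in_def s_def cs'_def)
    have 2: "?t + p = ?u + ?N * of_bool (snd (s r))"
      using add_cells_difference [of r a "carry_in a" cs] rep
      by (simp add: carry_in_def s_def cs'_def represents_def)
    have less: "?u < ?N" "?t < ?N"
      using weight_less [of _ cs'] by (simp_all add: cs'_def)
    have "weight (\<lambda>c. fst (snd c) r) (assign a cs) = (if exceeds s r then ?t else ?u)"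
      unfolding as weight_map
      by (auto simp: select_cell_def case_prod_unfold intro!: weight_cong)
    also have "\<dots> = ?X mod p"
    proof (cases "?X < p")
      case True
      then have "\<not> fst (s r) \<and> snd (s r)"
        using 1 2 p by (cases "fst (s r)"; cases "snd (s r)") auto
      with 1 True show ?thesis by (simp add: exceeds_def)
    next
      case False
      then have "?X mod p = ?X - p"
        using X by (simp add: mod_if)
      \<comment> \<open>Overflow alone would force \<open>?X \<ge> ?N + p > 2 * p\<close>, and a
        borrow alone \<open>?t \<ge> ?N\<close>. So they occur together and cancel, or not at
        all.\<close>
      moreover have "exceeds s r \<and> ?t = ?X - p"
        using 1 2 less False X p by (cases "fst (s r)"; cases "snd (s r)") (auto simp: exceeds_def)
      ultimately show ?thesis by simp
    qed
    finally show ?thesis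
      using p by (simp add: assign_mod_def)
  qed
  with modulus show ?thesis
    by (simp add: represents_def)
qed

definition bits_val :: "bool list \<Rightarrow> nat" where
  "bits_val bs = fold (\<lambda>b n. 2 * n + of_bool b) bs 0"

context streamer
begin

definition mod_step :: "nat \<Rightarrow> letter \<Rightarrow> 'q \<times> ('r \<Rightarrow> nat) \<Rightarrow> 'q \<times> ('r \<Rightarrow> nat)" where
  "mod_step p l = (\<lambda>(q, \<rho>). case upd q l (\<lambda>x y. reg_val \<rho> x = reg_val \<rho> y) of
     (q', a, a') \<Rightarrow> (q', assign_mod p a' (assign_mod p a \<rho>)))"

lemma cell_step_mod_step:
  assumes "represents p \<rho> cs"
  shows "fst (cell_step l (q, cs)) = fst (mod_step p l (q, \<rho>))"
    and "represents p (snd (mod_step p l (q, \<rho>))) (snd (cell_step l (q, cs)))"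
proof -
  have "observe cs = (\<lambda>x y. reg_val \<rho> x = reg_val \<rho> y)"
    by (intro ext) (rule observe_eq [OF assms])
  then show "fst (cell_step l (q, cs)) = fst (mod_step p l (q, \<rho>))"
    "represents p (snd (mod_step p l (q, \<rho>))) (snd (cell_step l (q, cs)))"
    using assms by (simp_all add: cell_step_def mod_step_def represents_assign split: prod.splits)
qed

lemma fold_mod_step:
  assumes "represents p (snd d) (snd c)" "fst d = fst c"
  shows "fst (fold cell_step u c) = fst (fold (mod_step p) u d) \<and>
    represents p (snd (fold (mod_step p) u d)) (snd (fold cell_step u c))"
  using assms
proof (induction u arbitrary: c d)
  case (Cons l u)
  then show ?case
    using cell_step_mod_step [of p "snd d" "snd c" l "fst c"] Cons.IH [of "mod_step p l d" "cell_step l c"]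
    by (cases c; cases d) simp
qed simp

lemma weight_load_cells: "weight fst (load_cells bs) = bits_val bs"
  by (induction bs rule: rev_induct) (simp_all add: load_cells_def bits_val_def)

theorem accepted_streamer_mod:
  assumes "bits_val bs > 0"
  shows "map Bit bs @ Sep # u \<in> accepted ctl_step Load \<longleftrightarrow>
    (case fold (mod_step (bits_val bs)) u (q0, \<lambda>_. 0) of
      (q, \<rho>) \<Rightarrow> fin q (\<lambda>x y. reg_val \<rho> x = reg_val \<rho> y))"
proof -
  let ?p = "bits_val bs"
  have "weight (\<lambda>c. fst (snd c) r) (load_cells bs :: 'r cell list) = 0" for r
    using weight_eq_iff [of "\<lambda>c. fst (snd c) r" "load_cells bs :: 'r cell list" "\<lambda>_. False"]
    by (auto simp: weight_False load_cells_def)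
  then have "represents ?p (\<lambda>_. 0) (load_cells bs :: 'r cell list)"
    using assms weight_load_cells [of bs] by (simp add: represents_def)
  then have *: "fst (fold cell_step u (q0, load_cells bs)) = fst (fold (mod_step ?p) u (q0, \<lambda>_. 0))"
    "represents ?p (snd (fold (mod_step ?p) u (q0, \<lambda>_. 0))) (snd (fold cell_step u (q0, load_cells bs)))"
    using fold_mod_step [of ?p "(q0, \<lambda>_. 0)" "(q0, load_cells bs)" u] by simp_all
  then show ?thesis
    unfolding accepted_streamer_iff verdict_def
    by (simp add: observe_eq [OF *(2), abs_def] case_prod_unfold)
qed

end

section \<open>Products of conjugates\<close>

text \<open>Entries are named with row and column counted from one, as in the mathematical notation.\<close>

datatype entry = E12 | E13 | E14 | E23 | E24 | E34

fun position :: "entry \<Rightarrow> nat \<times> nat" where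
  "position E12 = (0, 1)"
| "position E13 = (0, 2)"
| "position E14 = (0, 3)"
| "position E23 = (1, 2)"
| "position E24 = (1, 3)"
| "position E34 = (2, 3)"

definition entry :: "int mat \<Rightarrow> entry \<Rightarrow> int" where
  "entry A e = A $$ position e"

definition entry_sum :: "int mat list \<Rightarrow> entry \<Rightarrow> int" where
  "entry_sum Cs e = (\<Sum>C\<leftarrow>Cs. entry C e)"

lemma entry_sum_Nil [simp]: "entry_sum [] e = 0"
  and entry_sum_Cons [simp]: "entry_sum (C # Cs) e = entry C e + entry_sum Cs e"
  by (simp_all add: entry_sum_def)

text \<open>\<open>(x, y, z)\<close> is the superdiagonal and \<open>(u, v)\<close> the second diagonal of the conjugating matrix;
  \<open>D\<close>, \<open>E\<close>, \<open>F\<close> are the entries 13, 24 and 14 of the result.\<close>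

definition conj_to :: "int \<Rightarrow> int mat \<Rightarrow> int \<Rightarrow> int \<Rightarrow> int \<Rightarrow> bool" where
  "conj_to P C D E F \<longleftrightarrow> (\<exists>x y z u v.
     P dvd D - (entry C E13 + entry C E12 * y - entry C E23 * x) \<and>
     P dvd E - (entry C E24 + entry C E23 * z - entry C E34 * y) \<and>
     P dvd F - (entry C E14 + entry C E12 * v - entry C E34 * u + entry C E13 * z - x * E))"

text \<open>The entries 12, 23 and 34 of a product of conjugates are the sums of those of the
  factors, whatever the conjugators. Hence these entries appear in the cross terms as constants, and
  only three entries have to be tracked.\<close>

fun prod_to :: "int \<Rightarrow> int mat list \<Rightarrow> int \<Rightarrow> int \<Rightarrow> int \<Rightarrow> bool" where
  "prod_to P [] D E F \<longleftrightarrow> P dvd D \<and> P dvd E \<and> P dvd F"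
| "prod_to P (C # Cs) D E F \<longleftrightarrow> (\<exists>d e f D' E' F'. conj_to P C d e f \<and> prod_to P Cs D' E' F' \<and>
     P dvd D - (d + D' + entry C E12 * entry_sum Cs E23) \<and>
     P dvd E - (e + E' + entry C E23 * entry_sum Cs E34) \<and>
     P dvd F - (f + F' + entry C E12 * E' + d * entry_sum Cs E34))"

lemma conj_toI:
  assumes "P dvd D - (entry C E13 + entry C E12 * y - entry C E23 * x)"
    and "P dvd E - (entry C E24 + entry C E23 * z - entry C E34 * y)"
    and "P dvd F - (entry C E14 + entry C E12 * v - entry C E34 * u + entry C E13 * z - x * E)"
  shows "conj_to P C D E F"
  using assms unfolding conj_to_def by blast

lemma conj_toE:
  assumes "conj_to P C D E F"
  obtains x y z u v where
    "P dvd D - (entry C E13 + entry C E12 * y - entry C E23 * x)"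
    "P dvd E - (entry C E24 + entry C E23 * z - entry C E34 * y)"
    "P dvd F - (entry C E14 + entry C E12 * v - entry C E34 * u + entry C E13 * z - x * E)"
  using assms unfolding conj_to_def by blast

lemma prod_to_ConsI:
  assumes "conj_to P C d e f" "prod_to P Cs D' E' F'"
    and "P dvd D - (d + D' + entry C E12 * entry_sum Cs E23)"
    and "P dvd E - (e + E' + entry C E23 * entry_sum Cs E34)"
    and "P dvd F - (f + F' + entry C E12 * E' + d * entry_sum Cs E34)"
  shows "prod_to P (C # Cs) D E F"
  using assms unfolding prod_to.simps by blast

lemma prod_to_Cons_exact:
  assumes "conj_to P C d e f" "prod_to P Cs D' E' F'"
  shows "prod_to P (C # Cs) (d + D' + entry C E12 * entry_sum Cs E23)
    (e + E' + entry C E23 * entry_sum Cs E34) (f + F' + entry C E12 * E' + d * entry_sum Cs E34)"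
  by (rule prod_to_ConsI [OF assms]) simp_all

text \<open>\<^emph>\<open>algebra\<close> eliminates a hypothesis that equates a variable with a term before it computes
  the ideal; the form \<open>a - 0\<close> prevents this.\<close>

lemma dvd_minus_zero: "P dvd a \<Longrightarrow> P dvd a - 0" for a :: int
  by simp

lemma prod_to_ConsE:
  assumes "prod_to P (C # Cs) D E F"
  obtains d e f D' E' F' where "conj_to P C d e f" "prod_to P Cs D' E' F'"
    "P dvd D - (d + D' + entry C E12 * entry_sum Cs E23)"
    "P dvd E - (e + E' + entry C E23 * entry_sum Cs E34)"
    "P dvd F - (f + F' + entry C E12 * E' + d * entry_sum Cs E34)"
  using assms unfolding prod_to.simps by blast

declare prod_to.simps(2) [simp del]

lemma conj_to_self: "conj_to P C (entry C E13) (entry C E24) (entry C E14)"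
  by (rule conj_toI [of _ _ _ 0 0 _ 0 _ 0 0]) simp_all

lemma conj_to_cong:
  assumes "conj_to P C D E F" "P dvd D - D'" "P dvd E - E'" "P dvd F - F'"
  shows "conj_to P C D' E' F'"
proof -
  from assms(1) obtain x y z u v where
    "P dvd D - (entry C E13 + entry C E12 * y - entry C E23 * x)"
    "P dvd E - (entry C E24 + entry C E23 * z - entry C E34 * y)"
    "P dvd F - (entry C E14 + entry C E12 * v - entry C E34 * u + entry C E13 * z - x * E)"
    by (rule conj_toE)
  with assms show ?thesis
    by (intro conj_toI [of _ _ _ y x _ z _ v u]) Groebner_Basis.algebra+
qed

lemma prod_to_cong:
  assumes "prod_to P Cs D E F" "P dvd D - D'" "P dvd E - E'" "P dvd F - F'"
  shows "prod_to P Cs D' E' F'"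
proof (cases Cs)
  case Nil
  have "P dvd x'" if "P dvd x" "P dvd x - x'" for x x'
    using dvd_diff [OF that] by simp
  with assms show ?thesis unfolding Nil prod_to.simps by blast
next
  case (Cons C Cs')
  with assms(1) obtain d e f D1 E1 F1 where h: "conj_to P C d e f" "prod_to P Cs' D1 E1 F1"
    "P dvd D - (d + D1 + entry C E12 * entry_sum Cs' E23)"
    "P dvd E - (e + E1 + entry C E23 * entry_sum Cs' E34)"
    "P dvd F - (f + F1 + entry C E12 * E1 + d * entry_sum Cs' E34)"
    by (auto elim: prod_to_ConsE)
  show ?thesis
    unfolding Cons using h(3-5) assms(2-4)
    by (intro prod_to_ConsI [OF h(1,2)]) Groebner_Basis.algebra+
qed

lemma prod_to_nonempty: "\<exists>D E F. prod_to P Cs D E F"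
proof (induction Cs)
  case Nil
  show ?case by (intro exI [of _ 0]) simp
next
  case (Cons C Cs)
  then obtain D E F where "prod_to P Cs D E F" by blast
  from prod_to_Cons_exact [OF conj_to_self this] show ?case by blast
qed

section \<open>Moving the corner and the second diagonal\<close>

lemma prime_inverse:
  fixes P a :: int
  assumes "prime P" "\<not> P dvd a"
  obtains i where "P dvd a * i - 1"
proof -
  have "coprime a P"
    using assms by (simp add: prime_imp_coprime coprime_commute)
  then obtain i j where "a * i + P * j = 1"
    by (metis bezout_int coprime_iff_gcd_eq_1 mult.commute)
  then have "a * i - 1 = P * (- j)" by simp
  then show ?thesis using that by (metis dvd_triv_left)
qed

text \<open>These are the classes closed under multiplication by the centre, whose elements differ
  from the identity at most in entry 14.\<close>

definition central_free :: "int \<Rightarrow> int mat \<Rightarrow> bool" where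
  "central_free P C \<longleftrightarrow> \<not> P dvd entry C E12 \<or> \<not> P dvd entry C E34 \<or>
     P dvd entry C E23 \<and> (\<not> P dvd entry C E13 \<or> \<not> P dvd entry C E24)"

context
  fixes P :: int
  assumes prime: "prime P"
begin

text \<open>In each case one parameter enters the equation for \<open>F\<close> with an invertible
  coefficient, up to sign: \<open>v\<close> with entry 12, \<open>u\<close> with entry 34,
  \<open>z\<close> with entry 13, \<open>x\<close> with \<open>E\<close>. In the last two cases
  entry 23 is zero, so that changing \<open>z\<close> or \<open>x\<close> does not disturb
  \<open>D\<close> and \<open>E\<close>.\<close>

lemma conj_to_central:
  assumes "conj_to P C D E F" "central_free P C"
  shows "conj_to P C D E F'"
proof -
  from assms(1) obtain x y z u v where
    h: "P dvd D - (entry C E13 + entry C E12 * y - entry C E23 * x)"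
    "P dvd E - (entry C E24 + entry C E23 * z - entry C E34 * y)"
    "P dvd F - (entry C E14 + entry C E12 * v - entry C E34 * u + entry C E13 * z - x * E)"
    by (rule conj_toE)
  consider "\<not> P dvd entry C E12" | "\<not> P dvd entry C E34"
    | "P dvd entry C E12" "P dvd entry C E34" "P dvd entry C E23" "\<not> P dvd entry C E13"
    | "P dvd entry C E12" "P dvd entry C E34" "P dvd entry C E23" "\<not> P dvd entry C E24"
    using assms(2) unfolding central_free_def by blast
  then show ?thesis
  proof cases
    case 1
    from prime_inverse [OF prime this] obtain i where i: "P dvd entry C E12 * i - 1" .
    show ?thesis
      by (rule conj_toI [OF h(1,2), of _ "v + i * (F' - F)" u]) (use h i in Groebner_Basis.algebra)
  next
    case 2
    from prime_inverse [OF prime this] obtain i where i: "P dvd entry C E34 * i - 1" .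
    show ?thesis
      by (rule conj_toI [OF h(1,2), of _ v "u - i * (F' - F)"]) (use h i in Groebner_Basis.algebra)
  next
    case 3
    from prime_inverse [OF prime 3(4)] obtain i where i: "P dvd entry C E13 * i - 1" .
    show ?thesis
    proof (rule conj_toI [of _ _ _ y x _ "z + i * (F' - F)" _ v u])
      show "P dvd E - (entry C E24 + entry C E23 * (z + i * (F' - F)) - entry C E34 * y)"
        using h(2) dvd_minus_zero [OF 3(3)] by Groebner_Basis.algebra
    qed (use h i in \<open>blast | Groebner_Basis.algebra\<close>)+
  next
    case 4
    from prime_inverse [OF prime 4(4)] obtain i where i: "P dvd entry C E24 * i - 1" .
    show ?thesis
    \<comment> \<open>Entries 23 and 34 vanish, so \<open>E\<close> is congruent to entry 24 and the
      coefficient of \<open>x\<close> is invertible.\<close>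
    proof (rule conj_toI [of _ _ _ y "x - i * (F' - F)" _ z _ v u])
      show "P dvd D - (entry C E13 + entry C E12 * y - entry C E23 * (x - i * (F' - F)))"
        using h(1) dvd_minus_zero [OF 4(3)] by Groebner_Basis.algebra
      show "P dvd F' - (entry C E14 + entry C E12 * v - entry C E34 * u + entry C E13 * z -
          (x - i * (F' - F)) * E)"
        using h(2,3) i 4(2,3) [THEN dvd_minus_zero] by Groebner_Basis.algebra
    qed (fact h)
  qed
qed

lemma prod_to_central:
  assumes "prod_to P Cs D E F" "\<exists>C \<in> set Cs. central_free P C"
  shows "prod_to P Cs D E F'"
  using assms
proof (induction Cs arbitrary: D E F F')
  case (Cons C Cs D E F F')
  from Cons.prems(1) obtain d e f D1 E1 F1 where h: "conj_to P C d e f" "prod_to P Cs D1 E1 F1"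
    "P dvd D - (d + D1 + entry C E12 * entry_sum Cs E23)"
    "P dvd E - (e + E1 + entry C E23 * entry_sum Cs E34)"
    "P dvd F - (f + F1 + entry C E12 * E1 + d * entry_sum Cs E34)"
    by (rule prod_to_ConsE)
  show ?case
  proof (cases "central_free P C")
    case True
    have "conj_to P C d e (F' - (F1 + entry C E12 * E1 + d * entry_sum Cs E34))"
      by (rule conj_to_central [OF h(1) True])
    then show ?thesis
      by (rule prod_to_ConsI [OF _ h(2-4)]) simp
  next
    case False
    then have "prod_to P Cs D1 E1 (F' - (f + entry C E12 * E1 + d * entry_sum Cs E34))"
      using Cons.IH [OF h(2)] Cons.prems(2) by simp
    then show ?thesis
      by (rule prod_to_ConsI [OF h(1) _ h(3,4)]) simp
  qed
qed simp

text \<open>With \<open>y = 0\<close>, the parameters \<open>x\<close> and \<open>z\<close> solve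
  for \<open>D\<close> and \<open>E\<close> separately, both with coefficient
  \<open>entry C E23\<close> up to sign; \<open>F\<close> is whatever results.\<close>

lemma conj_to_middle:
  assumes "\<not> P dvd entry C E23"
  shows "\<exists>F. conj_to P C D E F"
proof -
  from prime_inverse [OF prime assms] obtain i where i: "P dvd entry C E23 * i - 1" .
  have "conj_to P C D E (entry C E14 + entry C E13 * (i * (E - entry C E24)) - (i * (entry C E13 - D)) * E)"
    by (rule conj_toI [of _ _ _ 0 "i * (entry C E13 - D)" _ "i * (E - entry C E24)" _ 0 0])
      (use i in \<open>Groebner_Basis.algebra | simp\<close>)+
  then show ?thesis ..
qed

lemma prod_to_middle:
  assumes "\<exists>C \<in> set Cs. \<not> P dvd entry C E23"
  shows "\<exists>F. prod_to P Cs D E F"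
  using assms
proof (induction Cs arbitrary: D E)
  case (Cons C Cs)
  show ?case
  proof (cases "P dvd entry C E23")
    case False
    obtain D' E' F' where h: "prod_to P Cs D' E' F'"
      using prod_to_nonempty by blast
    obtain f where f: "conj_to P C (D - (D' + entry C E12 * entry_sum Cs E23))
        (E - (E' + entry C E23 * entry_sum Cs E34)) f"
      using conj_to_middle [OF False] by blast
    have "prod_to P (C # Cs) D E (f + F' + entry C E12 * E' +
        (D - (D' + entry C E12 * entry_sum Cs E23)) * entry_sum Cs E34)"
      by (rule prod_to_ConsI [OF f h]) simp_all
    then show ?thesis ..
  next
    case True
    then obtain F' where h: "prod_to P Cs (D - (entry C E13 + entry C E12 * entry_sum Cs E23))
        (E - (entry C E24 + entry C E23 * entry_sum Cs E34)) F'"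
      using Cons by auto
    have "prod_to P (C # Cs) D E (entry C E14 + F' + entry C E12 * (E - (entry C E24 +
        entry C E23 * entry_sum Cs E34)) + entry C E13 * entry_sum Cs E34)"
      by (rule prod_to_ConsI [OF conj_to_self h]) simp_all
    then show ?thesis ..
  qed
qed simp

end

section \<open>No middle entries: linear algebra on the second diagonal\<close>

lemma dvd_entry_sum: "(\<And>C. C \<in> set Cs \<Longrightarrow> P dvd entry C e) \<Longrightarrow> P dvd entry_sum Cs e"
  by (induction Cs) auto

text \<open>All conjugators are trivial. The cross terms of entries 13 and 24 contain an entry 23 or
  a sum of such entries and vanish modulo \<open>P\<close>.\<close>

lemma prod_to_entry_sum:
  assumes "\<forall>C \<in> set Cs. P dvd entry C E23"
  shows "\<exists>F. prod_to P Cs (entry_sum Cs E13) (entry_sum Cs E24) F"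
  using assms
proof (induction Cs)
  case (Cons C Cs)
  then obtain F where h: "prod_to P Cs (entry_sum Cs E13) (entry_sum Cs E24) F"
    by auto
  have "P dvd entry_sum Cs E23" "P dvd entry C E23"
    using Cons.prems by (auto intro: dvd_entry_sum)
  then have "prod_to P (C # Cs) (entry_sum (C # Cs) E13) (entry_sum (C # Cs) E24)
      (entry C E14 + F + entry C E12 * entry_sum Cs E24 + entry C E13 * entry_sum Cs E34)"
    by (intro prod_to_ConsI [OF conj_to_self h]) simp_all
  then show ?case ..
qed (auto intro: dvd_0_right)

text \<open>Adding \<open>t\<close> to \<open>y\<close> moves the second diagonal in the direction
  \<open>(a, - c)\<close>, where \<open>a\<close> and \<open>c\<close> are the entries 12 and
  34.\<close>

lemma conj_to_shift:
  assumes "conj_to P C D E F"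
  shows "\<exists>F. conj_to P C (D + entry C E12 * t) (E - entry C E34 * t) F"
proof -
  from assms obtain x y z u v where
    h: "P dvd D - (entry C E13 + entry C E12 * y - entry C E23 * x)"
    "P dvd E - (entry C E24 + entry C E23 * z - entry C E34 * y)"
    by (rule conj_toE)
  have "conj_to P C (D + entry C E12 * t) (E - entry C E34 * t)
      (entry C E14 + entry C E12 * 0 - entry C E34 * 0 + entry C E13 * z - x * (E - entry C E34 * t))"
    by (rule conj_toI [of _ _ _ "y + t" x _ z _ 0 0])
      (use h in \<open>simp_all add: algebra_simps\<close>)
  then show ?thesis ..
qed

lemma prod_to_shift:
  assumes "prod_to P Cs D E F" "C \<in> set Cs" "\<forall>C \<in> set Cs. P dvd entry C E23"
  shows "\<exists>F. prod_to P Cs (D + entry C E12 * t) (E - entry C E34 * t) F"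
  using assms
proof (induction Cs arbitrary: D E F)
  case (Cons B Cs D E F)
  from Cons.prems(1) obtain d e f D1 E1 F1 where h: "conj_to P B d e f" "prod_to P Cs D1 E1 F1"
    "P dvd D - (d + D1 + entry B E12 * entry_sum Cs E23)"
    "P dvd E - (e + E1 + entry B E23 * entry_sum Cs E34)"
    by (rule prod_to_ConsE)
  show ?case
  proof (cases "C = B")
    case True
    obtain f' where f': "conj_to P B (d + entry C E12 * t) (e - entry C E34 * t) f'"
      using conj_to_shift [OF h(1)] True by blast
    have "prod_to P (B # Cs) (D + entry C E12 * t) (E - entry C E34 * t)
        (f' + F1 + entry B E12 * E1 + (d + entry C E12 * t) * entry_sum Cs E34)"
      by (rule prod_to_ConsI [OF f' h(2)]) (use h(3,4) in \<open>simp_all add: algebra_simps\<close>)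
    then show ?thesis ..
  next
    case False
    then obtain F' where F': "prod_to P Cs (D1 + entry C E12 * t) (E1 - entry C E34 * t) F'"
      using Cons.IH [OF h(2)] Cons.prems(2,3) by auto
    have "prod_to P (B # Cs) (D + entry C E12 * t) (E - entry C E34 * t)
        (f + F' + entry B E12 * (E1 - entry C E34 * t) + d * entry_sum Cs E34)"
      by (rule prod_to_ConsI [OF h(1) F']) (use h(3,4) in \<open>simp_all add: algebra_simps\<close>)
    then show ?thesis ..
  qed
qed simp

text \<open>The pair \<open>(l, m)\<close> annihilates every direction \<open>(a, - c)\<close> in
  which the second diagonal can move, so this combination keeps the value that it has for trivial
  conjugators.\<close>

lemma prod_to_invariant:
  assumes "prod_to P Cs D E F" "\<forall>C \<in> set Cs. P dvd entry C E23"
    and "\<forall>C \<in> set Cs. P dvd l * entry C E12 - m * entry C E34"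
  shows "P dvd l * (D - entry_sum Cs E13) + m * (E - entry_sum Cs E24)"
  using assms
proof (induction Cs arbitrary: D E F)
  case Nil
  then show ?case by simp
next
  case (Cons C Cs D E F)
  from Cons.prems(1) obtain d e f D1 E1 F1 where h: "conj_to P C d e f" "prod_to P Cs D1 E1 F1"
    "P dvd D - (d + D1 + entry C E12 * entry_sum Cs E23)"
    "P dvd E - (e + E1 + entry C E23 * entry_sum Cs E34)"
    by (rule prod_to_ConsE)
  from h(1) obtain x y z u v where
    c: "P dvd d - (entry C E13 + entry C E12 * y - entry C E23 * x)"
    "P dvd e - (entry C E24 + entry C E23 * z - entry C E34 * y)"
    by (rule conj_toE)
  have b: "P dvd entry C E23 - 0" "P dvd entry_sum Cs E23 - 0"
    using Cons.prems(2) by (auto intro: dvd_entry_sum)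
  have ac: "P dvd l * entry C E12 - m * entry C E34"
    using Cons.prems(3) by simp
  have "P dvd l * (D1 - entry_sum Cs E13) + m * (E1 - entry_sum Cs E24)"
    using Cons.IH [OF h(2)] Cons.prems(2,3) by simp
  then have "P dvd l * (D - (entry C E13 + entry_sum Cs E13)) + m * (E - (entry C E24 + entry_sum Cs E24))"
    using h(3,4) c b ac by Groebner_Basis.algebra
  then show ?case by simp
qed

context
  fixes P :: int
  assumes prime: "prime P"
begin

lemma prod_to_rank_two:
  assumes "\<forall>C \<in> set Cs. P dvd entry C E23" "J \<in> set Cs" "K \<in> set Cs"
    and det: "\<not> P dvd entry J E12 * entry K E34 - entry K E12 * entry J E34"
  shows "prod_to P Cs 0 0 0"
proof -
  let ?D = "entry_sum Cs E13" and ?E = "entry_sum Cs E24"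
  from prime_inverse [OF prime det] obtain i where
    i: "P dvd (entry J E12 * entry K E34 - entry K E12 * entry J E34) * i - 1" .
  \<comment> \<open>Cramer's rule for \<open>a_J s + a_K t = - ?D\<close> and
    \<open>c_J s + c_K t = ?E\<close>, with \<open>a\<close> and \<open>c\<close> the entries 12 and
    34.\<close>
  define s where "s = - i * (?D * entry K E34 + ?E * entry K E12)"
  define t where "t = i * (?D * entry J E34 + ?E * entry J E12)"
  obtain F where "prod_to P Cs ?D ?E F"
    using prod_to_entry_sum [OF assms(1)] by blast
  then obtain F where "prod_to P Cs (?D + entry J E12 * s) (?E - entry J E34 * s) F"
    using prod_to_shift [OF _ assms(2,1)] by blast
  then obtain F where "prod_to P Cs (?D + entry J E12 * s + entry K E12 * t)
      (?E - entry J E34 * s - entry K E34 * t) F"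
    using prod_to_shift [OF _ assms(3,1)] by blast
  then have F: "prod_to P Cs 0 0 F"
    by (rule prod_to_cong) (use i in \<open>simp_all only: s_def t_def diff_self dvd_0_right\<close>,
        Groebner_Basis.algebra+)
  have "\<not> P dvd entry J E12 \<or> \<not> P dvd entry J E34"
    using det by (meson dvd_diff dvd_mult dvd_mult2)
  then have "central_free P J"
    by (auto simp: central_free_def)
  with assms(2) show ?thesis
    using prod_to_central [OF prime F] by blast
qed

text \<open>All directions are parallel to that of \<open>J\<close>, which the pair of entries 34
  and 12 of \<open>J\<close> annihilates; this gives necessity. Conversely, one shift along
  \<open>J\<close> clears a coordinate with invertible coefficient, and the condition then clears
  the other.\<close>

lemma prod_to_rank_one:
  assumes "\<forall>C \<in> set Cs. P dvd entry C E23" "J \<in> set Cs"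
    and nz: "\<not> (P dvd entry J E12 \<and> P dvd entry J E34)"
    and par: "\<forall>K \<in> set Cs. P dvd entry J E12 * entry K E34 - entry K E12 * entry J E34"
  shows "prod_to P Cs 0 0 0 \<longleftrightarrow>
    P dvd entry J E34 * entry_sum Cs E13 + entry J E12 * entry_sum Cs E24"
proof
  assume "prod_to P Cs 0 0 0"
  moreover have "\<forall>C \<in> set Cs. P dvd entry J E34 * entry C E12 - entry J E12 * entry C E34"
    using par by (subst dvd_diff_commute) (simp add: mult.commute)
  ultimately have "P dvd entry J E34 * (0 - entry_sum Cs E13) + entry J E12 * (0 - entry_sum Cs E24)"
    using prod_to_invariant [OF _ assms(1)] by blast
  then have "P dvd - (entry J E34 * (0 - entry_sum Cs E13) + entry J E12 * (0 - entry_sum Cs E24))"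
    by (subst dvd_minus_iff)
  then show "P dvd entry J E34 * entry_sum Cs E13 + entry J E12 * entry_sum Cs E24"
    by (simp add: algebra_simps)
next
  assume h: "P dvd entry J E34 * entry_sum Cs E13 + entry J E12 * entry_sum Cs E24"
  let ?D = "entry_sum Cs E13" and ?E = "entry_sum Cs E24"
  obtain F0 where F0: "prod_to P Cs ?D ?E F0"
    using prod_to_entry_sum [OF assms(1)] by blast
  have "\<exists>F. prod_to P Cs 0 0 F"
  proof (cases "P dvd entry J E12")
    case False
    from prime_inverse [OF prime this] obtain i where i: "P dvd entry J E12 * i - 1" .
    obtain F where F: "prod_to P Cs (?D + entry J E12 * (- i * ?D)) (?E - entry J E34 * (- i * ?D)) F"
      using prod_to_shift [OF F0 assms(2,1)] by blast
    have "prod_to P Cs 0 0 F"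
      by (rule prod_to_cong [OF F]) (use i h in \<open>simp_all only: diff_self dvd_0_right\<close>,
        Groebner_Basis.algebra+)
    then show ?thesis ..
  next
    case True
    then have "\<not> P dvd entry J E34" using nz by simp
    from prime_inverse [OF prime this] obtain i where i: "P dvd entry J E34 * i - 1" .
    obtain F where F: "prod_to P Cs (?D + entry J E12 * (i * ?E)) (?E - entry J E34 * (i * ?E)) F"
      using prod_to_shift [OF F0 assms(2,1)] by blast
    have "prod_to P Cs 0 0 F"
      by (rule prod_to_cong [OF F]) (use i h in \<open>simp_all only: diff_self dvd_0_right\<close>,
        Groebner_Basis.algebra+)
    then show ?thesis ..
  qed
  moreover have "central_free P J"
    using nz by (auto simp: central_free_def)
  ultimately show "prod_to P Cs 0 0 0"
    using prod_to_central [OF prime] assms(2) by blast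
qed

lemma prod_to_middle_central:
  assumes "\<exists>C \<in> set Cs. \<not> P dvd entry C E23" "\<exists>C \<in> set Cs. central_free P C"
  shows "prod_to P Cs 0 0 0"
  using prod_to_middle [OF prime assms(1)] prod_to_central [OF prime _ assms(2)] by blast

text \<open>Without a factor that moves the corner entry, \<open>b F - d e\<close> is a complete invariant of
  a conjugacy class with middle entry \<open>b\<close>.\<close>

lemma conj_to_iff:
  assumes "\<not> central_free P C" "\<not> P dvd entry C E23"
  shows "conj_to P C D E F \<longleftrightarrow>
    P dvd entry C E23 * (F - entry C E14) + entry C E13 * entry C E24 - D * E"
proof
  have ac: "P dvd entry C E12 - 0" "P dvd entry C E34 - 0"
    using assms(1) by (auto simp: central_free_def)
  {
    assume "conj_to P C D E F"
    then obtain x y z u v where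
      "P dvd D - (entry C E13 + entry C E12 * y - entry C E23 * x)"
      "P dvd E - (entry C E24 + entry C E23 * z - entry C E34 * y)"
      "P dvd F - (entry C E14 + entry C E12 * v - entry C E34 * u + entry C E13 * z - x * E)"
      by (rule conj_toE)
    with ac show "P dvd entry C E23 * (F - entry C E14) + entry C E13 * entry C E24 - D * E"
      by Groebner_Basis.algebra
  }
  assume h: "P dvd entry C E23 * (F - entry C E14) + entry C E13 * entry C E24 - D * E"
  from prime_inverse [OF prime assms(2)] obtain i where i: "P dvd entry C E23 * i - 1" .
  show "conj_to P C D E F"
    by (rule conj_toI [of _ _ _ 0 "i * (entry C E13 - D)" _ "i * (E - entry C E24)" _ 0 0])
      (use i h in Groebner_Basis.algebra)+
qed

text \<open>Such a matrix differs from the identity at most in entry 14. It is therefore central and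
  forms a class by itself.\<close>

lemma conj_to_rigid_iff:
  assumes "\<not> central_free P C" "P dvd entry C E23"
  shows "conj_to P C D E F \<longleftrightarrow> P dvd D \<and> P dvd E \<and> P dvd F - entry C E14"
proof
  have z: "P dvd entry C E12 - 0" "P dvd entry C E34 - 0" "P dvd entry C E23 - 0"
    "P dvd entry C E13 - 0" "P dvd entry C E24 - 0"
    using assms by (auto simp: central_free_def)
  {
    assume "conj_to P C D E F"
    then obtain x y z u v where h:
      "P dvd D - (entry C E13 + entry C E12 * y - entry C E23 * x)"
      "P dvd E - (entry C E24 + entry C E23 * z - entry C E34 * y)"
      "P dvd F - (entry C E14 + entry C E12 * v - entry C E34 * u + entry C E13 * z - x * E)"
      by (rule conj_toE)
    have D: "P dvd D" using h(1) z by Groebner_Basis.algebra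
    have E: "P dvd E" using h(2) z by Groebner_Basis.algebra
    have "P dvd F - entry C E14" using h(3) z dvd_minus_zero [OF E] by Groebner_Basis.algebra
    with D E show "P dvd D \<and> P dvd E \<and> P dvd F - entry C E14" by simp
  }
  assume h: "P dvd D \<and> P dvd E \<and> P dvd F - entry C E14"
  have "P dvd entry C E13 - D" "P dvd entry C E24 - E" "P dvd entry C E14 - F"
    using h z by (auto simp: dvd_diff_commute [of _ F])
  then show "conj_to P C D E F"
    by (rule conj_to_cong [OF conj_to_self])
qed

section \<open>Products in which no factor moves the corner\<close>

abbreviation active :: "int mat list \<Rightarrow> int mat list" where
  "active Cs \<equiv> filter (\<lambda>C. \<not> P dvd entry C E23) Cs"

text \<open>Entries 12 and 34 vanish throughout, and with them all cross terms, so the remaining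
  entries simply add up.\<close>

lemma prod_to_Cons_rigid:
  assumes "\<forall>C \<in> set (C # Cs). \<not> central_free P C"
  shows "prod_to P (C # Cs) D E F \<longleftrightarrow>
    (\<exists>d e f. conj_to P C d e f \<and> prod_to P Cs (D - d) (E - e) (F - f))"
proof
  have "P dvd entry C E12" "P dvd entry_sum Cs E34"
    using assms by (auto simp: central_free_def intro: dvd_entry_sum)
  then have z: "P dvd entry C E12 - 0" "P dvd entry_sum Cs E34 - 0" by simp_all
  {
    assume "prod_to P (C # Cs) D E F"
    then obtain d e f D1 E1 F1 where h: "conj_to P C d e f" "prod_to P Cs D1 E1 F1"
      "P dvd D - (d + D1 + entry C E12 * entry_sum Cs E23)"
      "P dvd E - (e + E1 + entry C E23 * entry_sum Cs E34)"
      "P dvd F - (f + F1 + entry C E12 * E1 + d * entry_sum Cs E34)"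
      by (rule prod_to_ConsE)
    have "prod_to P Cs (D - d) (E - e) (F - f)"
      by (rule prod_to_cong [OF h(2)]) (use h(3-5) z in Groebner_Basis.algebra)+
    with h(1) show "\<exists>d e f. conj_to P C d e f \<and> prod_to P Cs (D - d) (E - e) (F - f)" by blast
  }
  assume "\<exists>d e f. conj_to P C d e f \<and> prod_to P Cs (D - d) (E - e) (F - f)"
  then obtain d e f where h: "conj_to P C d e f" "prod_to P Cs (D - d) (E - e) (F - f)" by blast
  show "prod_to P (C # Cs) D E F"
    by (rule prod_to_ConsI [OF h]) (use z in \<open>simp_all\<close>)
qed

lemma prod_to_Cons_inactive:
  assumes "\<forall>C \<in> set (C # Cs). \<not> central_free P C" "P dvd entry C E23"
  shows "prod_to P (C # Cs) D E F \<longleftrightarrow> prod_to P Cs D E (F - entry C E14)"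
proof
  assume "prod_to P (C # Cs) D E F"
  then obtain d e f where h: "P dvd d" "P dvd e" "P dvd f - entry C E14"
    "prod_to P Cs (D - d) (E - e) (F - f)"
    using assms by (auto simp: prod_to_Cons_rigid conj_to_rigid_iff)
  then show "prod_to P Cs D E (F - entry C E14)"
    by (auto intro: prod_to_cong [OF h(4)] simp: dvd_diff_commute [of _ "entry C E14"])
next
  assume "prod_to P Cs D E (F - entry C E14)"
  then have "conj_to P C 0 0 (entry C E14) \<and> prod_to P Cs (D - 0) (E - 0) (F - entry C E14)"
    using assms by (simp add: conj_to_rigid_iff)
  then show "prod_to P (C # Cs) D E F"
    unfolding prod_to_Cons_rigid [OF assms(1)] by blast
qed

lemma prod_to_active_none:
  assumes "\<forall>C \<in> set Cs. \<not> central_free P C" "active Cs = []"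
  shows "prod_to P Cs D E F \<longleftrightarrow> P dvd D \<and> P dvd E \<and> P dvd F - entry_sum Cs E14"
  using assms
proof (induction Cs arbitrary: F)
  case (Cons C Cs F)
  then have "P dvd entry C E23" by (simp split: if_splits)
  with Cons show ?case
    by (subst prod_to_Cons_inactive) (auto simp: algebra_simps)
qed simp

lemma prod_to_active_one:
  assumes "\<forall>C \<in> set Cs. \<not> central_free P C" "active Cs = [M]"
  shows "prod_to P Cs D E F \<longleftrightarrow>
    P dvd entry M E23 * (F - entry_sum Cs E14) + entry M E13 * entry M E24 - D * E"
  using assms
proof (induction Cs arbitrary: F)
  case (Cons C Cs F)
  show ?case
  proof (cases "P dvd entry C E23")
    case True
    with Cons show ?thesis
      by (subst prod_to_Cons_inactive) (auto simp: algebra_simps)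
  next
    case False
    with Cons.prems have C: "C = M" "active Cs = []" by auto
    let ?R = "entry_sum Cs E14"
    have "prod_to P (C # Cs) D E F \<longleftrightarrow> (\<exists>d e f.
        P dvd entry C E23 * (f - entry C E14) + entry C E13 * entry C E24 - d * e \<and>
        P dvd D - d \<and> P dvd E - e \<and> P dvd F - f - ?R)"
      using Cons.prems(1) False C(2)
      by (simp add: prod_to_Cons_rigid conj_to_iff prod_to_active_none)
    also have "\<dots> \<longleftrightarrow> P dvd entry C E23 * (F - (entry C E14 + ?R)) + entry C E13 * entry C E24 - D * E"
    proof
      assume "\<exists>d e f.
        P dvd entry C E23 * (f - entry C E14) + entry C E13 * entry C E24 - d * e \<and>
        P dvd D - d \<and> P dvd E - e \<and> P dvd F - f - ?R"
      then obtain d e f where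
        "P dvd entry C E23 * (f - entry C E14) + entry C E13 * entry C E24 - d * e"
        "P dvd D - d" "P dvd E - e" "P dvd F - f - ?R" by blast
      then show "P dvd entry C E23 * (F - (entry C E14 + ?R)) + entry C E13 * entry C E24 - D * E"
        by Groebner_Basis.algebra
    next
      assume "P dvd entry C E23 * (F - (entry C E14 + ?R)) + entry C E13 * entry C E24 - D * E"
      then show "\<exists>d e f.
        P dvd entry C E23 * (f - entry C E14) + entry C E13 * entry C E24 - d * e \<and>
        P dvd D - d \<and> P dvd E - e \<and> P dvd F - f - ?R"
        by (intro exI [of _ D] exI [of _ E] exI [of _ "F - ?R"]) (simp add: algebra_simps)
    qed
    finally show ?thesis using C(1) by simp
  qed
qed simp

text \<open>The factors have second diagonals \<open>(d, e)\<close> and \<open>(- d, - e)\<close>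
  with the same product. As their middle entries are opposite, subtracting one class equation from
  the other eliminates this product together with the unknown corner \<open>f\<close>.\<close>

lemma prod_to_active_two:
  assumes "\<forall>C \<in> set Cs. \<not> central_free P C" "active Cs = [M, N]"
    and opposite: "P dvd entry M E23 + entry N E23"
  shows "prod_to P Cs 0 0 F \<longleftrightarrow>
    P dvd entry M E23 * (F - entry_sum Cs E14) + entry M E13 * entry M E24 - entry N E13 * entry N E24"
  using assms(1,2)
proof (induction Cs arbitrary: F)
  case (Cons C Cs F)
  show ?case
  proof (cases "P dvd entry C E23")
    case True
    with Cons show ?thesis
      by (subst prod_to_Cons_inactive) (auto simp: algebra_simps)
  next
    case False
    with Cons.prems have C: "C = M" "active Cs = [N]" by auto
    let ?R = "entry_sum Cs E14"
    have eq: "prod_to P (C # Cs) 0 0 F \<longleftrightarrow> (\<exists>d e f.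
        P dvd entry M E23 * (f - entry M E14) + entry M E13 * entry M E24 - d * e \<and>
        P dvd entry N E23 * (F - f - ?R) + entry N E13 * entry N E24 - (0 - d) * (0 - e))"
      using Cons.prems(1) False C
      by (simp add: prod_to_Cons_rigid conj_to_iff prod_to_active_one)
    have "prod_to P (C # Cs) 0 0 F \<longleftrightarrow>
      P dvd entry M E23 * (F - (entry M E14 + ?R)) + entry M E13 * entry M E24 - entry N E13 * entry N E24"
    proof
      assume "prod_to P (C # Cs) 0 0 F"
      then obtain d e f where
        "P dvd entry M E23 * (f - entry M E14) + entry M E13 * entry M E24 - d * e"
        "P dvd entry N E23 * (F - f - ?R) + entry N E13 * entry N E24 - (0 - d) * (0 - e)"
        unfolding eq by blast
      with opposite show "P dvd entry M E23 * (F - (entry M E14 + ?R)) +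
          entry M E13 * entry M E24 - entry N E13 * entry N E24"
        by Groebner_Basis.algebra
    next
      assume h: "P dvd entry M E23 * (F - (entry M E14 + ?R)) +
        entry M E13 * entry M E24 - entry N E13 * entry N E24"
      have "\<not> P dvd entry M E23" using False C by simp
      from prime_inverse [OF prime this] obtain i where i: "P dvd entry M E23 * i - 1" .
      \<comment> \<open>The corner of the conjugate of \<open>M\<close> whose second diagonal is
        zero.\<close>
      let ?f = "entry M E14 - i * (entry M E13 * entry M E24)"
      have "P dvd entry M E23 * (?f - entry M E14) + entry M E13 * entry M E24 - 0 * 0"
        "P dvd entry N E23 * (F - ?f - ?R) + entry N E13 * entry N E24 - (0 - 0) * (0 - 0)"
        using h i opposite by Groebner_Basis.algebra+
      then show "prod_to P (C # Cs) 0 0 F" unfolding eq by blast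
    qed
    then show ?thesis using C(1) by simp
  qed
qed simp

text \<open>For the last two active factors, setting one coordinate of \<open>(d, e)\<close> to zero
  fixes \<open>f\<close> by the first class equation and makes the second linear in the other
  coordinate, with coefficient \<open>D\<close> or \<open>E\<close>. Any earlier active factor is
  sent to \<open>(0, 0)\<close>, which leaves the target unchanged.\<close>

lemma prod_to_active_two_nonzero:
  assumes "\<forall>C \<in> set Cs. \<not> central_free P C" "length (active Cs) \<ge> 2"
    and "\<not> (P dvd D \<and> P dvd E)"
  shows "prod_to P Cs D E F"
  using assms
proof (induction Cs arbitrary: F)
  case (Cons C Cs F)
  note rigid = Cons.prems(1)
  consider "P dvd entry C E23" | "\<not> P dvd entry C E23" "length (active Cs) \<ge> 2"
    | M where "\<not> P dvd entry C E23" "active Cs = [M]"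
  proof (cases "P dvd entry C E23")
    case False
    then have "length (active Cs) \<ge> 1" using Cons.prems(2) by simp
    then have "length (active Cs) \<ge> 2 \<or> (\<exists>M. active Cs = [M])"
      by (cases "active Cs"; cases "tl (active Cs)") auto
    then show ?thesis using that False by blast
  qed simp
  then show ?case
  proof cases
    case 1
    with Cons show ?thesis
      by (subst prod_to_Cons_inactive) auto
  next
    case 2
    from conj_to_middle [OF prime 2(1), of 0 0] obtain f where "conj_to P C 0 0 f" by blast
    moreover have "prod_to P Cs (D - 0) (E - 0) (F - f)"
      using Cons.IH 2 Cons.prems by simp
    ultimately show ?thesis
      unfolding prod_to_Cons_rigid [OF rigid] by blast
  next
    case (3 M)
    then have "\<not> P dvd entry M E23"
      by (metis filter_eq_ConsD)
    then obtain j where j: "P dvd entry M E23 * j - 1"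
      using prime_inverse [OF prime] by blast
    obtain i where i: "P dvd entry C E23 * i - 1"
      using prime_inverse [OF prime 3(1)] by blast
    let ?R = "entry_sum Cs E14"
    let ?f = "entry C E14 - i * (entry C E13 * entry C E24)"
    let ?w = "entry M E23 * (F - ?f - ?R) + entry M E13 * entry M E24"
    have eq: "prod_to P (C # Cs) D E F \<longleftrightarrow> (\<exists>d e f.
        P dvd entry C E23 * (f - entry C E14) + entry C E13 * entry C E24 - d * e \<and>
        P dvd entry M E23 * (F - f - ?R) + entry M E13 * entry M E24 - (D - d) * (E - e))"
      using 3 rigid by (simp add: prod_to_Cons_rigid conj_to_iff prod_to_active_one)
    show ?thesis
    proof (cases "P dvd D")
      case False
      then obtain k where k: "P dvd D * k - 1"
        using prime_inverse [OF prime] by blast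
      have "P dvd entry C E23 * (?f - entry C E14) + entry C E13 * entry C E24 - 0 * (E - k * ?w)"
        "P dvd ?w - (D - 0) * (E - (E - k * ?w))"
        using i k by Groebner_Basis.algebra+
      then show ?thesis unfolding eq by blast
    next
      case True
      then have "\<not> P dvd E" using assms(3) by simp
      then obtain k where k: "P dvd E * k - 1"
        using prime_inverse [OF prime] by blast
      have "P dvd entry C E23 * (?f - entry C E14) + entry C E13 * entry C E24 - (D - k * ?w) * 0"
        "P dvd ?w - (D - (D - k * ?w)) * (E - 0)"
        using i k by Groebner_Basis.algebra+
      then show ?thesis unfolding eq by blast
    qed
  qed
qed simp

lemma prod_to_active_three:
  assumes "\<forall>C \<in> set Cs. \<not> central_free P C" "length (active Cs) \<ge> 3"
  shows "prod_to P Cs 0 0 F"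
  using assms
proof (induction Cs arbitrary: F)
  case (Cons C Cs F)
  show ?case
  proof (cases "P dvd entry C E23")
    case True
    with Cons show ?thesis
      by (subst prod_to_Cons_inactive) auto
  next
    case False
    \<comment> \<open>Sending this factor to \<open>(1, 0)\<close> leaves the nonzero target
      \<open>(-1, 0)\<close> to at least two active factors.\<close>
    from conj_to_middle [OF prime this, of 1 0] obtain f where f: "conj_to P C 1 0 f" by blast
    have "\<not> P dvd 1" using prime not_prime_unit by blast
    then have "\<not> P dvd 0 - 1" by simp
    then have "prod_to P Cs (0 - 1) (0 - 0) (F - f)"
      using False Cons.prems by (intro prod_to_active_two_nonzero) auto
    with f show ?thesis
      unfolding prod_to_Cons_rigid [OF Cons.prems(1)] by blast
  qed
qed simp

text \<open>There is no direction to move in, so both coordinates of the second diagonal are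
  invariants. If moreover no factor moves the corner, all factors are central and their corners add
  up.\<close>

lemma prod_to_no_superdiagonal:
  assumes "\<forall>C \<in> set Cs. P dvd entry C E12 \<and> P dvd entry C E23 \<and> P dvd entry C E34"
  shows "prod_to P Cs 0 0 0 \<longleftrightarrow> P dvd entry_sum Cs E13 \<and> P dvd entry_sum Cs E24 \<and>
    ((\<exists>C \<in> set Cs. central_free P C) \<or> P dvd entry_sum Cs E14)"
proof -
  have b: "\<forall>C \<in> set Cs. P dvd entry C E23" using assms by simp
  have inv: "P dvd l * (0 - entry_sum Cs E13) + m * (0 - entry_sum Cs E24)"
    if "prod_to P Cs 0 0 0" for l m
    using assms by (intro prod_to_invariant [OF that b]) auto
  then have nec: "P dvd entry_sum Cs E13 \<and> P dvd entry_sum Cs E24" if "prod_to P Cs 0 0 0"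
    using inv [OF that, of 1 0] inv [OF that, of 0 1] by simp
  have suf: "\<exists>F. prod_to P Cs 0 0 F" if "P dvd entry_sum Cs E13" "P dvd entry_sum Cs E24"
    using prod_to_entry_sum [OF b] prod_to_cong [of P Cs _ _ _ 0 0] that
    by (metis diff_self diff_zero dvd_0_right)
  show ?thesis
  proof (cases "\<exists>C \<in> set Cs. central_free P C")
    case True
    then show ?thesis
      using nec suf prod_to_central [OF prime _ True] by blast
  next
    case False
    moreover have "active Cs = []" using b by (simp add: filter_empty_conv)
    moreover have "P dvd entry_sum Cs E13" "P dvd entry_sum Cs E24"
      using False b by (auto simp: central_free_def intro!: dvd_entry_sum)
    ultimately show ?thesis
      using prod_to_active_none [of Cs 0 0 0] by auto
  qed
qed

end

section \<open>Coordinates of the unitriangular group\<close>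

fun product_entry :: "(entry \<Rightarrow> int) \<Rightarrow> (entry \<Rightarrow> int) \<Rightarrow> entry \<Rightarrow> int" where
  "product_entry g h E13 = g E13 + h E13 + g E12 * h E23"
| "product_entry g h E24 = g E24 + h E24 + g E23 * h E34"
| "product_entry g h E14 = g E14 + h E14 + g E12 * h E24 + g E13 * h E34"
| "product_entry g h e = g e + h e"

lemma position_less: "fst (position e) < snd (position e)" "snd (position e) < 4"
  by (cases e; simp)+

lemma entry_mult:
  assumes "A \<in> carrier (UT 4 p)" "B \<in> carrier (UT 4 p)"
  shows "entry (A \<otimes>\<^bsub>UT 4 p\<^esub> B) e = product_entry (entry A) (entry B) e mod int p"
proof -
  have c: "A \<in> carrier_mat 4 4" "B \<in> carrier_mat 4 4"
    using assms UT_carrierD by auto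
  have one: "A $$ (i, i) = 1" "B $$ (i, i) = 1" if "i < 4" for i
    using assms that by (auto simp: UT_def)
  have zero: "A $$ (i, j) = 0" "B $$ (i, j) = 0" if "j < i" "i < 4" for i j
    using assms that by (auto simp: UT_def)
  have "(A * B) $$ (i, j) = A $$ (i, 0) * B $$ (0, j) + A $$ (i, 1) * B $$ (1, j) +
      A $$ (i, 2) * B $$ (2, j) + A $$ (i, 3) * B $$ (3, j)" if "i < 4" "j < 4" for i j
    using c that by (simp add: scalar_prod_def eval_nat_numeral)
  then show ?thesis
    using c one zero
    by (cases e) (simp_all add: UT_def reduce_mat_def entry_def algebra_simps)
qed

lemma dvd_entry_mult:
  assumes "A \<in> carrier (UT 4 p)" "B \<in> carrier (UT 4 p)"
  shows "int p dvd entry (A \<otimes>\<^bsub>UT 4 p\<^esub> B) e - product_entry (entry A) (entry B) e"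
  unfolding entry_mult [OF assms] by (simp flip: mod_eq_dvd_iff)

lemma entry_range:
  assumes "A \<in> carrier (UT 4 p)"
  shows "0 \<le> entry A e" "entry A e < int p"
  using assms by (cases e; simp add: UT_def entry_def)+

lemma entry_cong_eq:
  assumes "A \<in> carrier (UT 4 p)" "B \<in> carrier (UT 4 p)" "int p dvd entry A e - entry B e"
  shows "entry A e = entry B e"
proof -
  have "entry A e mod int p = entry B e mod int p"
    using assms(3) by (simp add: mod_eq_dvd_iff)
  then show ?thesis
    using entry_range [OF assms(1)] entry_range [OF assms(2)] by simp
qed

lemma UT_eqI:
  assumes "A \<in> carrier (UT 4 p)" "B \<in> carrier (UT 4 p)"
    and "\<And>e. int p dvd entry A e - entry B e"
  shows "A = B"
proof -
  note eq = entry_cong_eq [OF assms(1,2) assms(3)]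
  have up: "A $$ (i, j) = B $$ (i, j)" if "i < j" "j < 4" for i j
    using that eq [of E12] eq [of E13] eq [of E14] eq [of E23] eq [of E24] eq [of E34]
    by (auto simp: entry_def eval_nat_numeral less_Suc_eq)
  have low: "A $$ (i, j) = 0" "B $$ (i, j) = 0" if "j < i" "i < 4" for i j
    using assms(1,2) that by (auto simp: UT_def)
  have "A $$ (i, i) = B $$ (i, i)" if "i < 4" for i
    using assms(1,2) that by (auto simp: UT_def)
  then have "A $$ (i, j) = B $$ (i, j)" if "i < 4" "j < 4" for i j
    using up [of i j] low [of j i] that by (cases i j rule: linorder_cases) auto
  moreover have "A \<in> carrier_mat 4 4" "B \<in> carrier_mat 4 4"
    using assms UT_carrierD by auto
  ultimately show ?thesis by (intro eq_matI) auto
qed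

lemma UT_exists:
  assumes "p > 1"
  shows "\<exists>Z \<in> carrier (UT 4 p). \<forall>e. int p dvd entry Z e - g e"
proof
  \<comment> \<open>\<open>SOME\<close> inverts \<open>position\<close>, which is a bijection onto
    the places above the diagonal; the first two branches fill the other places.\<close>
  let ?Z = "mat 4 4 (\<lambda>ij. if fst ij = snd ij then 1 else if snd ij < fst ij then 0 else
    g (SOME e. position e = ij) mod int p)"
  show "?Z \<in> carrier (UT 4 p)"
    using assms by (auto simp: UT_def intro!: upper_triangularI)
  have "e' = e" if "position e' = position e" for e e'
    using that by (cases e; cases e'; simp)
  then have some: "(SOME e'. position e' = position e) = e" for e
    by (intro some_equality) auto
  have "entry ?Z e = g e mod int p" for e
  proof -
    obtain i j where "position e = (i, j)" by force
    then show ?thesis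
      using position_less [of e] some [of e] by (simp add: entry_def)
  qed
  then show "\<forall>e. int p dvd entry ?Z e - g e"
    by (simp flip: mod_eq_dvd_iff)
qed

text \<open>Writing the equation as \<open>C Z = Z C'\<close> avoids the entries of the inverse and
  leaves one polynomial congruence per entry. Once the superdiagonal of \<open>C'\<close> is
  replaced by that of \<open>C\<close>, those for entries 13, 24 and 14 are
  \<open>conj_to\<close>.\<close>

lemma conjugate_iff:
  assumes p: "p > 1" and C: "C \<in> carrier (UT 4 p)" "C' \<in> carrier (UT 4 p)"
  shows "(\<exists>Z \<in> carrier (UT 4 p). inv\<^bsub>UT 4 p\<^esub> Z \<otimes>\<^bsub>UT 4 p\<^esub> C \<otimes>\<^bsub>UT 4 p\<^esub> Z = C') \<longleftrightarrow>
    (\<forall>e \<in> {E12, E23, E34}. int p dvd entry C' e - entry C e) \<and>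
    conj_to (int p) C (entry C' E13) (entry C' E24) (entry C' E14)"
proof -
  interpret group "UT 4 p" by (rule UT_group [OF p])
  let ?G = "UT 4 p" and ?P = "int p"
  have comm: "inv\<^bsub>?G\<^esub> Z \<otimes>\<^bsub>?G\<^esub> C \<otimes>\<^bsub>?G\<^esub> Z = C' \<longleftrightarrow>
      (\<forall>e. ?P dvd product_entry (entry C) (entry Z) e - product_entry (entry Z) (entry C') e)"
    if Z: "Z \<in> carrier ?G" for Z
  proof -
    have "inv\<^bsub>?G\<^esub> Z \<otimes>\<^bsub>?G\<^esub> C \<otimes>\<^bsub>?G\<^esub> Z = C' \<longleftrightarrow> C \<otimes>\<^bsub>?G\<^esub> Z = Z \<otimes>\<^bsub>?G\<^esub> C'"
      using inv_solve_left [of C' Z "C \<otimes>\<^bsub>?G\<^esub> Z"] C Z by (simp add: m_assoc eq_commute)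
    also have "\<dots> \<longleftrightarrow> (\<forall>e. entry (C \<otimes>\<^bsub>?G\<^esub> Z) e = entry (Z \<otimes>\<^bsub>?G\<^esub> C') e)"
      using UT_eqI [of "C \<otimes>\<^bsub>?G\<^esub> Z" p "Z \<otimes>\<^bsub>?G\<^esub> C'"] C Z by auto
    also have "\<dots> \<longleftrightarrow> (\<forall>e. ?P dvd product_entry (entry C) (entry Z) e - product_entry (entry Z) (entry C') e)"
      using C Z by (simp add: entry_mult mod_eq_dvd_iff)
    finally show ?thesis .
  qed
  show ?thesis
  proof
    assume "\<exists>Z \<in> carrier ?G. inv\<^bsub>?G\<^esub> Z \<otimes>\<^bsub>?G\<^esub> C \<otimes>\<^bsub>?G\<^esub> Z = C'"
    then obtain Z where "Z \<in> carrier ?G"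
      and *: "\<And>e. ?P dvd product_entry (entry C) (entry Z) e - product_entry (entry Z) (entry C') e"
      using comm by blast
    have abc: "?P dvd entry C' E12 - entry C E12" "?P dvd entry C' E23 - entry C E23"
      "?P dvd entry C' E34 - entry C E34"
      using * [of E12] * [of E23] * [of E34]
      by (simp_all add: dvd_diff_commute [of _ "entry C' _"])
    have "conj_to ?P C (entry C' E13) (entry C' E24) (entry C' E14)"
      by (rule conj_toI [of _ _ _ "entry Z E23" "entry Z E12" _ "entry Z E34" _ "entry Z E24" "entry Z E13"])
        (use abc * [of E13, simplified] * [of E24, simplified] * [of E14, simplified]
          in Groebner_Basis.algebra)+
    with abc show "(\<forall>e \<in> {E12, E23, E34}. ?P dvd entry C' e - entry C e) \<and>
        conj_to ?P C (entry C' E13) (entry C' E24) (entry C' E14)" by simp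
  next
    assume "(\<forall>e \<in> {E12, E23, E34}. ?P dvd entry C' e - entry C e) \<and>
        conj_to ?P C (entry C' E13) (entry C' E24) (entry C' E14)"
    then have abc: "?P dvd entry C' E12 - entry C E12" "?P dvd entry C' E23 - entry C E23"
      "?P dvd entry C' E34 - entry C E34"
      and conj: "conj_to ?P C (entry C' E13) (entry C' E24) (entry C' E14)" by auto
    from conj obtain x y z u v where h:
      "?P dvd entry C' E13 - (entry C E13 + entry C E12 * y - entry C E23 * x)"
      "?P dvd entry C' E24 - (entry C E24 + entry C E23 * z - entry C E34 * y)"
      "?P dvd entry C' E14 - (entry C E14 + entry C E12 * v - entry C E34 * u + entry C E13 * z
        - x * entry C' E24)"
      by (rule conj_toE)
    \<comment> \<open>Entry 14 of the conjugator cancels from both sides, so any value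
      serves.\<close>
    define g where "g = (\<lambda>e. case e of E12 \<Rightarrow> x | E23 \<Rightarrow> y | E34 \<Rightarrow> z | E13 \<Rightarrow> u | E24 \<Rightarrow> v | E14 \<Rightarrow> 0)"
    obtain Z where Z: "Z \<in> carrier ?G" "\<And>e. ?P dvd entry Z e - g e"
      using UT_exists [OF p, of g] by blast
    have zs: "?P dvd entry Z E12 - x" "?P dvd entry Z E23 - y" "?P dvd entry Z E34 - z"
      "?P dvd entry Z E13 - u" "?P dvd entry Z E24 - v"
      using Z(2) [of E12] Z(2) [of E23] Z(2) [of E34] Z(2) [of E13] Z(2) [of E24]
      by (simp_all add: g_def)
    have "?P dvd product_entry (entry C) (entry Z) e - product_entry (entry Z) (entry C') e" for e
    proof (cases e)
      case E13
      show ?thesis unfolding E13 product_entry.simps using abc(2) h(1) zs(1,2) by Groebner_Basis.algebra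
    next
      case E24
      show ?thesis unfolding E24 product_entry.simps using abc(3) h(2) zs(2,3) by Groebner_Basis.algebra
    next
      case E14
      show ?thesis unfolding E14 product_entry.simps
        using abc(3) h(2,3) zs(1,3-5) by Groebner_Basis.algebra
    qed (use abc in \<open>simp_all add: dvd_diff_commute [of _ "entry C _"]\<close>)
    then show "\<exists>Z \<in> carrier ?G. inv\<^bsub>?G\<^esub> Z \<otimes>\<^bsub>?G\<^esub> C \<otimes>\<^bsub>?G\<^esub> Z = C'"
      using comm Z(1) by blast
  qed
qed

lemma product_of_conjugates_Cons [simp]:
  "product_of_conjugates G (Z # Zs) (C # Cs) =
    (inv\<^bsub>G\<^esub> Z \<otimes>\<^bsub>G\<^esub> C \<otimes>\<^bsub>G\<^esub> Z) \<otimes>\<^bsub>G\<^esub> product_of_conjugates G Zs Cs"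
  by (simp add: product_of_conjugates_def)

lemma product_of_conjugates_closed:
  assumes "group G" "length Zs = length Cs" "set Zs \<subseteq> carrier G" "set Cs \<subseteq> carrier G"
  shows "product_of_conjugates G Zs Cs \<in> carrier G"
proof -
  interpret group G by fact
  show ?thesis
    using assms(2-4)
    by (induction Zs Cs rule: list_induct2) (auto simp: product_of_conjugates_def)
qed

lemma dvd_diff_add: "P dvd a - a' \<Longrightarrow> P dvd b - b' \<Longrightarrow> P dvd (a + b) - (a' + b')"
  for P :: int
  by Groebner_Basis.algebra

lemma dvd_diff_mult: "P dvd a - a' \<Longrightarrow> P dvd b - b' \<Longrightarrow> P dvd a * b - a' * b'"
  for P :: int
  by Groebner_Basis.algebra

lemma dvd_diff_trans: "P dvd a - b \<Longrightarrow> P dvd b - c \<Longrightarrow> P dvd a - c"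
  for P :: int
  by Groebner_Basis.algebra

lemma dvd_diff_trans_left: "P dvd a - b \<Longrightarrow> P dvd c - b \<Longrightarrow> P dvd a - c"
  for P :: int
  by Groebner_Basis.algebra

text \<open>The product \<open>X\<close> is arbitrary, although only the identity is of interest,
  because the induction splits \<open>X\<close> into a conjugate of the first factor and a product
  of conjugates of the rest.\<close>

lemma product_of_conjugates_iff:
  assumes p: "p > 1" and "set Cs \<subseteq> carrier (UT 4 p)" "X \<in> carrier (UT 4 p)"
  shows "(\<exists>Zs. length Zs = length Cs \<and> set Zs \<subseteq> carrier (UT 4 p) \<and>
      product_of_conjugates (UT 4 p) Zs Cs = X) \<longleftrightarrow>
    (\<forall>e \<in> {E12, E23, E34}. int p dvd entry X e - entry_sum Cs e) \<and>
    prod_to (int p) Cs (entry X E13) (entry X E24) (entry X E14)"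
  using assms(2,3)
proof (induction Cs arbitrary: X)
  case Nil
  interpret group "UT 4 p" by (rule UT_group [OF p])
  have "entry \<one>\<^bsub>UT 4 p\<^esub> e = 0" for e
    by (cases e) (simp_all add: UT_def entry_def)
  then have "\<one>\<^bsub>UT 4 p\<^esub> = X \<longleftrightarrow> (\<forall>e. int p dvd entry X e)"
    using UT_eqI [of X p "\<one>\<^bsub>UT 4 p\<^esub>"] Nil by auto
  moreover have "(\<forall>e. Q e) \<longleftrightarrow> Q E12 \<and> Q E23 \<and> Q E34 \<and> Q E13 \<and> Q E24 \<and> Q E14" for Q
  proof (intro iffI allI)
    fix e assume "Q E12 \<and> Q E23 \<and> Q E34 \<and> Q E13 \<and> Q E24 \<and> Q E14"
    then show "Q e" by (cases e) auto
  qed simp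
  ultimately show ?case
    by (simp add: product_of_conjugates_def)
next
  case (Cons C Cs X)
  interpret group "UT 4 p" by (rule UT_group [OF p])
  let ?G = "UT 4 p" and ?P = "int p"
  have C: "C \<in> carrier ?G" and Cs: "set Cs \<subseteq> carrier ?G" using Cons.prems by auto
  have "(\<exists>Zs. length Zs = length (C # Cs) \<and> set Zs \<subseteq> carrier ?G \<and>
      product_of_conjugates ?G Zs (C # Cs) = X) \<longleftrightarrow>
    (\<exists>Z Zs. Z \<in> carrier ?G \<and> length Zs = length Cs \<and> set Zs \<subseteq> carrier ?G \<and>
      (inv\<^bsub>?G\<^esub> Z \<otimes>\<^bsub>?G\<^esub> C \<otimes>\<^bsub>?G\<^esub> Z) \<otimes>\<^bsub>?G\<^esub> product_of_conjugates ?G Zs Cs = X)"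
  proof
    assume "\<exists>Z Zs. Z \<in> carrier ?G \<and> length Zs = length Cs \<and> set Zs \<subseteq> carrier ?G \<and>
      (inv\<^bsub>?G\<^esub> Z \<otimes>\<^bsub>?G\<^esub> C \<otimes>\<^bsub>?G\<^esub> Z) \<otimes>\<^bsub>?G\<^esub> product_of_conjugates ?G Zs Cs = X"
    then obtain Z Zs where "Z \<in> carrier ?G" "length Zs = length Cs" "set Zs \<subseteq> carrier ?G"
      "(inv\<^bsub>?G\<^esub> Z \<otimes>\<^bsub>?G\<^esub> C \<otimes>\<^bsub>?G\<^esub> Z) \<otimes>\<^bsub>?G\<^esub> product_of_conjugates ?G Zs Cs = X" by blast
    then show "\<exists>Zs. length Zs = length (C # Cs) \<and> set Zs \<subseteq> carrier ?G \<and>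
        product_of_conjugates ?G Zs (C # Cs) = X"
      by (intro exI [of _ "Z # Zs"]) simp
  qed (auto simp: length_Suc_conv, blast)
  also have "\<dots> \<longleftrightarrow> (\<exists>C' X'. C' \<in> carrier ?G \<and> X' \<in> carrier ?G \<and>
      (\<exists>Z \<in> carrier ?G. inv\<^bsub>?G\<^esub> Z \<otimes>\<^bsub>?G\<^esub> C \<otimes>\<^bsub>?G\<^esub> Z = C') \<and>
      (\<exists>Zs. length Zs = length Cs \<and> set Zs \<subseteq> carrier ?G \<and> product_of_conjugates ?G Zs Cs = X') \<and>
      C' \<otimes>\<^bsub>?G\<^esub> X' = X)" (is "_ \<longleftrightarrow> ?R")
  proof
    assume "\<exists>Z Zs. Z \<in> carrier ?G \<and> length Zs = length Cs \<and> set Zs \<subseteq> carrier ?G \<and>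
      (inv\<^bsub>?G\<^esub> Z \<otimes>\<^bsub>?G\<^esub> C \<otimes>\<^bsub>?G\<^esub> Z) \<otimes>\<^bsub>?G\<^esub> product_of_conjugates ?G Zs Cs = X"
    then obtain Z Zs where h: "Z \<in> carrier ?G" "length Zs = length Cs" "set Zs \<subseteq> carrier ?G"
      "(inv\<^bsub>?G\<^esub> Z \<otimes>\<^bsub>?G\<^esub> C \<otimes>\<^bsub>?G\<^esub> Z) \<otimes>\<^bsub>?G\<^esub> product_of_conjugates ?G Zs Cs = X" by blast
    moreover have "inv\<^bsub>?G\<^esub> Z \<otimes>\<^bsub>?G\<^esub> C \<otimes>\<^bsub>?G\<^esub> Z \<in> carrier ?G"
      using h(1) C by simp
    moreover have "product_of_conjugates ?G Zs Cs \<in> carrier ?G"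
      using product_of_conjugates_closed [OF is_group h(2,3) Cs] .
    ultimately show ?R by blast
  qed blast
  also have "?R \<longleftrightarrow> (\<forall>e \<in> {E12, E23, E34}. ?P dvd entry X e - entry_sum (C # Cs) e) \<and>
    prod_to ?P (C # Cs) (entry X E13) (entry X E24) (entry X E14)"
  proof
    assume ?R
    then obtain C' X' where CX: "C' \<in> carrier ?G" "X' \<in> carrier ?G"
      and ex: "\<exists>Z \<in> carrier ?G. inv\<^bsub>?G\<^esub> Z \<otimes>\<^bsub>?G\<^esub> C \<otimes>\<^bsub>?G\<^esub> Z = C'"
        "\<exists>Zs. length Zs = length Cs \<and> set Zs \<subseteq> carrier ?G \<and> product_of_conjugates ?G Zs Cs = X'"
      and X: "C' \<otimes>\<^bsub>?G\<^esub> X' = X" by blast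
    have C': "C' \<in> carrier ?G" "\<forall>e \<in> {E12, E23, E34}. ?P dvd entry C' e - entry C e"
        "conj_to ?P C (entry C' E13) (entry C' E24) (entry C' E14)"
      and X': "X' \<in> carrier ?G" "\<forall>e \<in> {E12, E23, E34}. ?P dvd entry X' e - entry_sum Cs e"
        "prod_to ?P Cs (entry X' E13) (entry X' E24) (entry X' E14)"
      using CX ex(1) [unfolded conjugate_iff [OF p C CX(1)]] ex(2) [unfolded Cons.IH [OF Cs CX(2)]]
      by simp_all
    have m: "?P dvd entry X e - product_entry (entry C') (entry X') e" for e
      using dvd_entry_mult [OF C'(1) X'(1)] X by simp
    have c: "?P dvd entry C' E12 - entry C E12" "?P dvd entry C' E23 - entry C E23"
      "?P dvd entry C' E34 - entry C E34" using C'(2) by auto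
    have x: "?P dvd entry X' E12 - entry_sum Cs E12" "?P dvd entry X' E23 - entry_sum Cs E23"
      "?P dvd entry X' E34 - entry_sum Cs E34" using X'(2) by auto
    have "?P dvd entry X E12 - (entry C E12 + entry_sum Cs E12)"
      using m [of E12, simplified] c(1) x(1) by Groebner_Basis.algebra
    moreover have "?P dvd entry X E23 - (entry C E23 + entry_sum Cs E23)"
      using m [of E23, simplified] c(2) x(2) by Groebner_Basis.algebra
    moreover have "?P dvd entry X E34 - (entry C E34 + entry_sum Cs E34)"
      using m [of E34, simplified] c(3) x(3) by Groebner_Basis.algebra
    moreover have "prod_to ?P (C # Cs) (entry X E13) (entry X E24) (entry X E14)"
    proof (rule prod_to_ConsI [OF C'(3) X'(3)])
      show "?P dvd entry X E13 - (entry C' E13 + entry X' E13 + entry C E12 * entry_sum Cs E23)"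
        using m [of E13] c(1) x(2) unfolding product_entry.simps by Groebner_Basis.algebra
      show "?P dvd entry X E24 - (entry C' E24 + entry X' E24 + entry C E23 * entry_sum Cs E34)"
        using m [of E24] c(2) x(3) unfolding product_entry.simps by Groebner_Basis.algebra
      show "?P dvd entry X E14 - (entry C' E14 + entry X' E14 + entry C E12 * entry X' E24 +
          entry C' E13 * entry_sum Cs E34)"
        using m [of E14] c(1) x(3) unfolding product_entry.simps by Groebner_Basis.algebra
    qed
    ultimately show "(\<forall>e \<in> {E12, E23, E34}. ?P dvd entry X e - entry_sum (C # Cs) e) \<and>
        prod_to ?P (C # Cs) (entry X E13) (entry X E24) (entry X E14)" by simp
  next
    assume "(\<forall>e \<in> {E12, E23, E34}. ?P dvd entry X e - entry_sum (C # Cs) e) \<and>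
        prod_to ?P (C # Cs) (entry X E13) (entry X E24) (entry X E14)"
    then have sup: "?P dvd entry X E12 - (entry C E12 + entry_sum Cs E12)"
        "?P dvd entry X E23 - (entry C E23 + entry_sum Cs E23)"
        "?P dvd entry X E34 - (entry C E34 + entry_sum Cs E34)"
      and "prod_to ?P (C # Cs) (entry X E13) (entry X E24) (entry X E14)" by auto
    from this(4) obtain d e f D E F where h: "conj_to ?P C d e f" "prod_to ?P Cs D E F"
      "?P dvd entry X E13 - (d + D + entry C E12 * entry_sum Cs E23)"
      "?P dvd entry X E24 - (e + E + entry C E23 * entry_sum Cs E34)"
      "?P dvd entry X E14 - (f + F + entry C E12 * E + d * entry_sum Cs E34)"
      by (rule prod_to_ConsE)
    obtain C' where C': "C' \<in> carrier ?G"
      "\<And>i. ?P dvd entry C' i - (case i of E13 \<Rightarrow> d | E24 \<Rightarrow> e | E14 \<Rightarrow> f | _ \<Rightarrow> entry C i)"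
      using UT_exists [OF p, of "\<lambda>i. case i of E13 \<Rightarrow> d | E24 \<Rightarrow> e | E14 \<Rightarrow> f | _ \<Rightarrow> entry C i"]
      by blast
    obtain X' where X': "X' \<in> carrier ?G"
      "\<And>i. ?P dvd entry X' i - (case i of E13 \<Rightarrow> D | E24 \<Rightarrow> E | E14 \<Rightarrow> F | _ \<Rightarrow> entry_sum Cs i)"
      using UT_exists [OF p, of "\<lambda>i. case i of E13 \<Rightarrow> D | E24 \<Rightarrow> E | E14 \<Rightarrow> F | _ \<Rightarrow> entry_sum Cs i"]
      by blast
    have c: "?P dvd entry C' E12 - entry C E12" "?P dvd entry C' E23 - entry C E23"
      "?P dvd entry C' E34 - entry C E34" "?P dvd entry C' E13 - d" "?P dvd entry C' E24 - e"
      "?P dvd entry C' E14 - f"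
      using C'(2) [of E12] C'(2) [of E23] C'(2) [of E34] C'(2) [of E13] C'(2) [of E24] C'(2) [of E14]
      by simp_all
    have x: "?P dvd entry X' E12 - entry_sum Cs E12" "?P dvd entry X' E23 - entry_sum Cs E23"
      "?P dvd entry X' E34 - entry_sum Cs E34" "?P dvd entry X' E13 - D" "?P dvd entry X' E24 - E"
      "?P dvd entry X' E14 - F"
      using X'(2) [of E12] X'(2) [of E23] X'(2) [of E34] X'(2) [of E13] X'(2) [of E24] X'(2) [of E14]
      by simp_all
    have "conj_to ?P C (entry C' E13) (entry C' E24) (entry C' E14)"
      by (rule conj_to_cong [OF h(1)]; subst dvd_diff_commute) (rule c)+
    then have 1: "\<exists>Z \<in> carrier ?G. inv\<^bsub>?G\<^esub> Z \<otimes>\<^bsub>?G\<^esub> C \<otimes>\<^bsub>?G\<^esub> Z = C'"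
      using conjugate_iff [OF p C C'(1)] c by simp
    have "prod_to ?P Cs (entry X' E13) (entry X' E24) (entry X' E14)"
      by (rule prod_to_cong [OF h(2)]; subst dvd_diff_commute) (rule x)+
    then have 2: "\<exists>Zs. length Zs = length Cs \<and> set Zs \<subseteq> carrier ?G \<and> product_of_conjugates ?G Zs Cs = X'"
      using Cons.IH [OF Cs X'(1)] x by simp
    have "C' \<otimes>\<^bsub>?G\<^esub> X' = X"
    proof (rule UT_eqI)
      fix i
      have m: "?P dvd entry (C' \<otimes>\<^bsub>?G\<^esub> X') i - product_entry (entry C') (entry X') i" for i
        by (rule dvd_entry_mult [OF C'(1) X'(1)])
      show "?P dvd entry (C' \<otimes>\<^bsub>?G\<^esub> X') i - entry X i"
      proof (cases i)
        case E12
        show ?thesis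
          using dvd_diff_trans [OF m [of E12] dvd_diff_trans_left [OF _ sup(1)]] c(1) x(1)
          unfolding E12 product_entry.simps by (blast intro: dvd_diff_add)
      next
        case E23
        show ?thesis
          using dvd_diff_trans [OF m [of E23] dvd_diff_trans_left [OF _ sup(2)]] c(2) x(2)
          unfolding E23 product_entry.simps by (blast intro: dvd_diff_add)
      next
        case E34
        show ?thesis
          using dvd_diff_trans [OF m [of E34] dvd_diff_trans_left [OF _ sup(3)]] c(3) x(3)
          unfolding E34 product_entry.simps by (blast intro: dvd_diff_add)
      next
        case E13
        show ?thesis
          using dvd_diff_trans [OF m [of E13] dvd_diff_trans_left [OF _ h(3)]] c(1,4) x(2,4)
          unfolding E13 product_entry.simps by (blast intro: dvd_diff_add dvd_diff_mult)
      next
        case E24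
        show ?thesis
          using dvd_diff_trans [OF m [of E24] dvd_diff_trans_left [OF _ h(4)]] c(2,5) x(3,5)
          unfolding E24 product_entry.simps by (blast intro: dvd_diff_add dvd_diff_mult)
      next
        case E14
        show ?thesis
          using dvd_diff_trans [OF m [of E14] dvd_diff_trans_left [OF _ h(5)]] c(1,4,6) x(3,5,6)
          unfolding E14 product_entry.simps by (blast intro: dvd_diff_add dvd_diff_mult)
      qed
    qed (use C' X' Cons.prems in auto)
    with 1 2 C'(1) X'(1) show ?R by (intro exI [of _ C'] exI [of _ X'] conjI)
  qed
  finally show ?case .
qed

theorem spherical_solvable_iff:
  assumes "p > 1" "set Cs \<subseteq> carrier (UT 4 p)"
  shows "spherical_solvable (p, Cs) \<longleftrightarrow>
    (\<forall>e \<in> {E12, E23, E34}. int p dvd entry_sum Cs e) \<and> prod_to (int p) Cs 0 0 0"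
proof -
  interpret group "UT 4 p" by (rule UT_group [OF assms(1)])
  have "entry \<one>\<^bsub>UT 4 p\<^esub> e = 0" for e
    by (cases e) (simp_all add: UT_def entry_def)
  then show ?thesis
    using product_of_conjugates_iff [OF assms one_closed] by (simp add: spherical_solvable_def)
qed

section \<open>The streaming decision procedure\<close>

text \<open>\<open>Prod i y\<close> receives the product of the entry \<open>i\<close> that is being read and register \<open>y\<close>.  The meaning
  of the other registers and of the flags is given by \<open>registers_correct\<close> and \<open>flags_correct\<close> below.
  A register \<open>Cur j\<close> is a valid factor of \<open>Prod i\<close> only if \<open>j\<close> precedes \<open>i\<close> in row order.\<close>

datatype base = Cur entry | Sum entry | First12 | First23 | First34

datatype reg = Base base | Prod entry base | Lin1 | Lin2 | Lin | Mid | De1 | De2 | Lhs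

datatype slot = S0 | S1 | S2 | S3 | S4 | S5 | S6 | S7 | S8 | S9 | S10 | S11 | S12 | S13 | S14 | S15

instance entry :: finite
proof
  have "x \<in> {E12, E13, E14, E23, E24, E34}" for x by (cases x) simp_all
  then show "finite (UNIV :: entry set)" by (metis finite.simps rev_finite_subset subsetI)
qed

instance slot :: finite
proof
  have "x \<in> {S0, S1, S2, S3, S4, S5, S6, S7, S8, S9, S10, S11, S12, S13, S14, S15}" for x
    by (cases x) simp_all
  then have "UNIV \<subseteq> {S0, S1, S2, S3, S4, S5, S6, S7, S8, S9, S10, S11, S12, S13, S14, S15}"
    by (rule subsetI)
  then show "finite (UNIV :: slot set)" by (rule finite_subset) simp
qed

instance base :: finite
proof
  have "x \<in> range Cur \<union> range Sum \<union> {First12, First23, First34}" for x by (cases x) simp_all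
  then have "UNIV \<subseteq> range Cur \<union> range Sum \<union> {First12, First23, First34}" by (rule subsetI)
  then show "finite (UNIV :: base set)" by (rule finite_subset) simp
qed

instance reg :: finite
proof
  have "x \<in> range Base \<union> case_prod Prod ` UNIV \<union> {Lin1, Lin2, Lin, Mid, De1, De2, Lhs}" for x
    by (cases x) (auto simp: image_iff)
  then have "UNIV \<subseteq> range Base \<union> case_prod Prod ` UNIV \<union> {Lin1, Lin2, Lin, Mid, De1, De2, Lhs}"
    by (rule subsetI)
  then show "finite (UNIV :: reg set)" by (rule finite_subset) simp
qed

text \<open>Slot \<open>4 i + j\<close> is the matrix entry with row \<open>i\<close> and column \<open>j\<close>, counted from zero.\<close>

fun slot_entry :: "slot \<Rightarrow> entry option" where
  "slot_entry S1 = Some E12"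
| "slot_entry S2 = Some E13"
| "slot_entry S3 = Some E14"
| "slot_entry S6 = Some E23"
| "slot_entry S7 = Some E24"
| "slot_entry S11 = Some E34"
| "slot_entry _ = None"

fun next_slot :: "slot \<Rightarrow> slot" where
  "next_slot S0 = S1" | "next_slot S1 = S2" | "next_slot S2 = S3" | "next_slot S3 = S4"
| "next_slot S4 = S5" | "next_slot S5 = S6" | "next_slot S6 = S7" | "next_slot S7 = S8"
| "next_slot S8 = S9" | "next_slot S9 = S10" | "next_slot S10 = S11" | "next_slot S11 = S12"
| "next_slot S12 = S13" | "next_slot S13 = S14" | "next_slot S14 = S15" | "next_slot S15 = S0"

type_synonym flags = "bool \<times> bool \<times> bool \<times> bool \<times> bool \<times> bool"

definition keep :: "reg assignment" where
  "keep r = (Some r, None, False)"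

text \<open>Doubling uses up both summands of an assignment, so Horner's step for the products needs
  the further assignment \<open>add_factor\<close>; for the entry itself the digit fits into the
  carry.\<close>

fun double :: "entry \<Rightarrow> bool \<Rightarrow> reg assignment" where
  "double i b (Base (Cur j)) = (Some (Base (Cur j)), if j = i then Some (Base (Cur j)) else None, j = i \<and> b)"
| "double i b (Prod j y) = (Some (Prod j y), if j = i then Some (Prod j y) else None, False)"
| "double i b r = keep r"

text \<open>\<open>Cur i\<close> is excluded because it changes while entry \<open>i\<close> is
  being read and so is no constant factor for Horner's scheme.\<close>

fun add_factor :: "entry \<Rightarrow> reg assignment" where
  "add_factor i (Prod j y) = (Some (Prod j y), if j = i \<and> y \<noteq> Cur i then Some (Base y) else None, False)"
| "add_factor i r = keep r"

text \<open>While no reference matrix is known, the current one is taken provisionally, to be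
  overwritten by the next unless it is of the required kind; afterwards contributions are just
  added. All sources are old values, so \<open>Sum e\<close> excludes the current matrix, and the
  product with its own entry supplies its share.\<close>

fun finish_matrix :: "flags \<Rightarrow> reg assignment" where
  "finish_matrix fl (Base (Cur e)) = (None, None, False)"
| "finish_matrix fl (Prod e y) = (None, None, False)"
| "finish_matrix fl (Base (Sum e)) = (Some (Base (Sum e)), Some (Base (Cur e)), False)"
| "finish_matrix (n1, n2, n3, ac, rk, fr) (Base First12) =
     (if ac then keep (Base First12) else keep (Base (Cur E12)))"
| "finish_matrix (n1, n2, n3, ac, rk, fr) (Base First34) =
     (if ac then keep (Base First34) else keep (Base (Cur E34)))"
| "finish_matrix (n1, n2, n3, ac, rk, fr) (Base First23) =
     (if n1 then keep (Base First23) else keep (Base (Cur E23)))"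
| "finish_matrix (n1, n2, n3, ac, rk, fr) Lin1 =
     (if ac then (Some Lin1, Some (Prod E13 First34), False)
      else (Some (Prod E34 (Sum E13)), Some (Prod E34 (Cur E13)), False))"
| "finish_matrix (n1, n2, n3, ac, rk, fr) Lin2 =
     (if ac then (Some Lin2, Some (Prod E24 First12), False)
      else (Some (Prod E12 (Sum E24)), Some (Prod E24 (Cur E12)), False))"
| "finish_matrix (n1, n2, n3, ac, rk, fr) Mid =
     (if n1 then (Some Mid, Some (Prod E14 First23), False)
      else (Some (Prod E23 (Sum E14)), Some (Prod E23 (Cur E14)), False))"
| "finish_matrix (n1, n2, n3, ac, rk, fr) De1 =
     (if n1 then keep De1 else keep (Prod E24 (Cur E13)))"
| "finish_matrix (n1, n2, n3, ac, rk, fr) De2 =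
     (if n2 then keep De2 else keep (Prod E24 (Cur E13)))"
| "finish_matrix fl Lin = keep Lin"
| "finish_matrix fl Lhs = keep Lhs"

fun add_up :: "reg assignment" where
  "add_up Lin = (Some Lin1, Some Lin2, False)"
| "add_up Lhs = (Some Mid, Some De2, False)"
| "add_up r = keep r"

text \<open>\<open>par\<close> is observed before the registers change and hence compares with an
  earlier reference matrix. Without one both products are zero and \<open>par\<close> holds, as it
  should for a matrix that becomes the reference itself.\<close>

fun finish_flags :: "flags \<Rightarrow> (entry \<Rightarrow> bool) \<Rightarrow> bool \<Rightarrow> flags" where
  "finish_flags (n1, n2, n3, ac, rk, fr) z par =
     (n1 \<or> \<not> z E23, n2 \<or> n1 \<and> \<not> z E23, n3 \<or> n2 \<and> \<not> z E23,
      ac \<or> \<not> z E12 \<or> \<not> z E34, rk \<or> \<not> par,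
      fr \<or> \<not> z E12 \<or> \<not> z E34 \<or> z E23 \<and> (\<not> z E13 \<or> \<not> z E24))"

fun update :: "slot \<times> flags \<Rightarrow> letter \<Rightarrow> reg observation \<Rightarrow> (slot \<times> flags) \<times> reg assignment \<times> reg assignment" where
  "update (s, fl) (Bit b) ob = (case slot_entry s of None \<Rightarrow> ((s, fl), keep, keep)
     | Some i \<Rightarrow> ((s, fl), double i b, if b then add_factor i else keep))"
| "update (s, fl) Sep ob =
     (if s = S15 then
       ((S0, finish_flags fl (\<lambda>e. ob (Some (Base (Cur e))) None)
          (ob (Some (Prod E12 First34)) (Some (Prod E34 First12)))), finish_matrix fl, add_up)
      else ((next_slot s, fl), keep, keep))"

text \<open>Once the entries 23 sum to zero, \<open>n1\<close> without \<open>n3\<close> means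
  exactly two nonzero ones, so that \<open>De1\<close> and \<open>De2\<close> are both meaningful
  where they are compared.\<close>

fun final :: "slot \<times> flags \<Rightarrow> reg observation \<Rightarrow> bool" where
  "final (s, n1, n2, n3, ac, rk, fr) ob \<longleftrightarrow>
     (let z = (\<lambda>r. ob (Some r) None) in
      z (Base (Sum E12)) \<and> z (Base (Sum E23)) \<and> z (Base (Sum E34)) \<and>
      (if n1 then fr \<or> n3 \<or> ob (Some Lhs) (Some De1)
       else (if ac then rk \<or> z Lin else z (Base (Sum E13)) \<and> z (Base (Sum E24))) \<and>
         (fr \<or> z (Base (Sum E14)))))"

definition initial :: "slot \<times> flags" where
  "initial = (S0, False, False, False, False, False, False)"

interpretation control: streamer initial update final .

section \<open>Reading one entry by Horner's scheme\<close>

definition read_entry :: "nat \<Rightarrow> (reg \<Rightarrow> nat) \<Rightarrow> entry \<Rightarrow> nat \<Rightarrow> reg \<Rightarrow> nat" where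
  "read_entry p \<rho> i n r = (case r of
     Base (Cur j) \<Rightarrow> if j = i then n mod p else \<rho> r
   | Prod j y \<Rightarrow> if j = i \<and> y \<noteq> Cur i then n * \<rho> (Base y) mod p else \<rho> r
   | _ \<Rightarrow> \<rho> r)"

lemma assign_mod_keep: "(\<And>r. \<rho> r < p) \<Longrightarrow> assign_mod p keep \<rho> = \<rho>"
  by (simp add: assign_mod_def keep_def fun_eq_iff)

lemma read_bits:
  assumes lt: "\<And>r. \<rho> r < p" and s: "slot_entry s = Some i"
    and clear: "\<rho> (Base (Cur i)) = 0" "\<And>y. \<rho> (Prod i y) = 0"
  shows "fold (control.mod_step p) (map Bit bs) ((s, fl), \<rho>) =
    ((s, fl), read_entry p \<rho> i (bits_val bs))"
proof (induction bs rule: rev_induct)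
  case Nil
  show ?case
    using clear by (auto simp: bits_val_def read_entry_def fun_eq_iff split: reg.split base.split)
next
  case (snoc b bs)
  have p: "p > 0" using lt [of Lin] by simp
  let ?m = "bits_val bs"
  have m: "bits_val (bs @ [b]) = 2 * ?m + of_bool b"
    by (simp add: bits_val_def)
  \<comment> \<open>The registers between the two assignments: the entry and its products are
    doubled and the entry has its new digit, but the products still lack their share for that
    digit.\<close>
  define \<rho>1 where "\<rho>1 = (\<lambda>r. case r of
      Base (Cur j) \<Rightarrow> if j = i then (2 * ?m + of_bool b) mod p else \<rho> r
    | Prod j y \<Rightarrow> if j = i \<and> y \<noteq> Cur i then (2 * ?m) * \<rho> (Base y) mod p else \<rho> r
    | _ \<Rightarrow> \<rho> r)"
  have dbl: "(n mod p + n mod p + c) mod p = (2 * n + c) mod p" for n c :: nat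
    by (metis mod_add_eq mod_add_left_eq mult_2)
  have 1: "assign_mod p (double i b) (read_entry p \<rho> i ?m) = \<rho>1"
  proof
    fix r
    show "assign_mod p (double i b) (read_entry p \<rho> i ?m) r = \<rho>1 r"
    proof (cases r)
      case (Base y)
      then show ?thesis
        using lt dbl [of ?m "of_bool b"]
        by (cases y) (auto simp: assign_mod_def \<rho>1_def read_entry_def keep_def)
    next
      case (Prod j y)
      then show ?thesis
        using lt clear dbl [of "?m * \<rho> (Base y)" 0]
        by (auto simp: assign_mod_def \<rho>1_def read_entry_def keep_def mult.assoc)
    qed (use lt in \<open>simp_all add: assign_mod_def \<rho>1_def read_entry_def keep_def\<close>)
  qed
  have \<rho>1_base: "\<rho>1 (Base y) = \<rho> (Base y)" if "y \<noteq> Cur i" for y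
    using that by (auto simp: \<rho>1_def split: base.split)
  have 2: "assign_mod p (if b then add_factor i else keep) \<rho>1 = read_entry p \<rho> i (2 * ?m + of_bool b)"
  proof
    fix r
    show "assign_mod p (if b then add_factor i else keep) \<rho>1 r =
        read_entry p \<rho> i (2 * ?m + of_bool b) r"
    proof (cases r)
      case (Base y)
      then show ?thesis
        using lt by (cases y) (auto simp: assign_mod_def \<rho>1_def read_entry_def keep_def)
    next
      case (Prod j y)
      then show ?thesis
        using lt clear \<rho>1_base [of y]
        by (auto simp: assign_mod_def \<rho>1_def read_entry_def keep_def mod_simps algebra_simps)
    qed (use lt in \<open>simp_all add: assign_mod_def \<rho>1_def read_entry_def keep_def\<close>)
  qed
  have "control.mod_step p (Bit b) ((s, fl), read_entry p \<rho> i ?m) =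
      ((s, fl), read_entry p \<rho> i (2 * ?m + of_bool b))"
    by (simp add: control.mod_step_def s 1 2)
  then show ?case using snoc m by simp
qed

lemma skip_bits:
  assumes lt: "\<And>r. \<rho> r < p" and s: "slot_entry s = None"
  shows "fold (control.mod_step p) (map Bit bs) ((s, fl), \<rho>) = ((s, fl), \<rho>)"
  using s by (induction bs) (simp_all add: control.mod_step_def assign_mod_keep [OF lt])

lemma bits_val_binary: "bits_val (binary n) = n"
proof (induction n rule: binary.induct)
  case (1 n)
  show ?case
  proof (cases "n < 2")
    case True
    then show ?thesis by (subst binary.simps) (auto simp: bits_val_def)
  next
    case False
    then have "bits_val (binary n) = 2 * bits_val (binary (n div 2)) + of_bool (odd n)"
      by (subst binary.simps) (simp add: bits_val_def)
    then show ?thesis using 1 False by simp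
  qed
qed

definition read_slot :: "nat \<Rightarrow> (reg \<Rightarrow> nat) \<Rightarrow> slot \<Rightarrow> nat \<Rightarrow> reg \<Rightarrow> nat" where
  "read_slot p \<rho> s n = (case slot_entry s of None \<Rightarrow> \<rho> | Some i \<Rightarrow> read_entry p \<rho> i n)"

lemma read_slot_less: "(\<And>r. \<rho> r < p) \<Longrightarrow> read_slot p \<rho> s n r < p"
proof -
  assume lt: "\<And>r. \<rho> r < p"
  have "p > 0" using lt [of Lin] by linarith
  with lt show ?thesis
    by (auto simp: read_slot_def read_entry_def split: option.split reg.split base.split)
qed

lemma read_number:
  assumes lt: "\<And>r. \<rho> r < p"
    and clear: "\<And>i. slot_entry s = Some i \<Longrightarrow> \<rho> (Base (Cur i)) = 0 \<and> (\<forall>y. \<rho> (Prod i y) = 0)"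
  shows "fold (control.mod_step p) (encode_num n) ((s, fl), \<rho>) =
    control.mod_step p Sep ((s, fl), read_slot p \<rho> s n)"
proof (cases "slot_entry s")
  case None
  then show ?thesis
    by (simp add: encode_num_def skip_bits [OF lt] read_slot_def)
next
  case (Some i)
  then show ?thesis
    using clear [OF Some] by (simp add: encode_num_def read_bits [OF lt Some] read_slot_def bits_val_binary)
qed

lemma read_number_next:
  assumes "\<And>r. \<rho> r < p" "s \<noteq> S15"
    and "\<And>i. slot_entry s = Some i \<Longrightarrow> \<rho> (Base (Cur i)) = 0 \<and> (\<forall>y. \<rho> (Prod i y) = 0)"
  shows "fold (control.mod_step p) (encode_num n) ((s, fl), \<rho>) =
    ((next_slot s, fl), read_slot p \<rho> s n)"
  using assms(2) read_slot_less [OF assms(1)]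
  by (simp add: read_number [OF assms(1,3)] control.mod_step_def assign_mod_keep)

section \<open>Reading one matrix\<close>

definition entry_nat :: "int mat \<Rightarrow> entry \<Rightarrow> nat" where
  "entry_nat C e = nat (entry C e)"

definition ready :: "nat \<Rightarrow> (reg \<Rightarrow> nat) \<Rightarrow> bool" where
  "ready p \<rho> \<longleftrightarrow> (\<forall>r. \<rho> r < p) \<and> (\<forall>e. \<rho> (Base (Cur e)) = 0) \<and> (\<forall>i y. \<rho> (Prod i y) = 0)"

definition encode_matrix :: "int mat \<Rightarrow> letter list" where
  "encode_matrix C = concat (map encode_num (map nat (concat (mat_to_list C))))"

definition read_matrix :: "nat \<Rightarrow> (reg \<Rightarrow> nat) \<Rightarrow> (entry \<Rightarrow> nat) \<Rightarrow> reg \<Rightarrow> nat" where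
  "read_matrix p \<rho> n = fold (\<lambda>i \<rho>. read_entry p \<rho> i (n i)) [E12, E13, E14, E23, E24, E34] \<rho>"

lemma read_numbers:
  assumes "\<And>r. \<rho> r < p" "s \<noteq> S15"
    and "case slot_entry s of None \<Rightarrow> True | Some i \<Rightarrow> \<rho> (Base (Cur i)) = 0 \<and> (\<forall>y. \<rho> (Prod i y) = 0)"
  shows "fold (control.mod_step p) (concat (map encode_num (n # ns))) ((s, fl), \<rho>) =
    fold (control.mod_step p) (concat (map encode_num ns)) ((next_slot s, fl), read_slot p \<rho> s n)"
proof -
  have "\<rho> (Base (Cur i)) = 0 \<and> (\<forall>y. \<rho> (Prod i y) = 0)" if "slot_entry s = Some i" for i
    using assms(3) that by simp
  then show ?thesis
    using read_number_next [of \<rho> p s n fl] assms(1,2) by simp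
qed

lemma mod_add_mult_mod: "(u + v * (w mod p)) mod p = (u + v * w) mod p" for u v w p :: nat
  by (metis mod_add_right_eq mod_mult_right_eq)

lemma read_entry_less: "(\<And>r. \<rho> r < p) \<Longrightarrow> read_entry p \<rho> i n r < p"
proof -
  assume lt: "\<And>r. \<rho> r < p"
  have "p > 0" using lt [of Lin] by linarith
  with lt show ?thesis
    by (auto simp: read_entry_def split: reg.split base.split)
qed

lemma read_entry_other:
  "j \<noteq> i \<Longrightarrow> read_entry p \<rho> i n (Base (Cur j)) = \<rho> (Base (Cur j))"
  "j \<noteq> i \<Longrightarrow> read_entry p \<rho> i n (Prod j y) = \<rho> (Prod j y)"
  by (simp_all add: read_entry_def)

lemma mat_to_list_4:
  assumes "C \<in> carrier_mat 4 4"
  shows "concat (mat_to_list C) =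
    [C $$ (0, 0), C $$ (0, 1), C $$ (0, 2), C $$ (0, 3), C $$ (1, 0), C $$ (1, 1), C $$ (1, 2), C $$ (1, 3),
     C $$ (2, 0), C $$ (2, 1), C $$ (2, 2), C $$ (2, 3), C $$ (3, 0), C $$ (3, 1), C $$ (3, 2), C $$ (3, 3)]"
  using assms by (auto simp: mat_to_list_def upt_conv_Cons eval_nat_numeral)

text \<open>The last separator stays unexecuted because it ends the matrix and triggers
  \<open>finish_flags\<close> and \<open>finish_matrix\<close>.\<close>

lemma fold_encode_matrix:
  assumes C: "C \<in> carrier_mat 4 4" and \<rho>: "ready p \<rho>"
  shows "fold (control.mod_step p) (encode_matrix C) ((S0, fl), \<rho>) =
    control.mod_step p Sep ((S15, fl), read_matrix p \<rho> (entry_nat C))"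
proof -
  have lt: "\<And>r. \<rho> r < p" and clear: "\<rho> (Base (Cur e)) = 0" "\<rho> (Prod e y) = 0" for e y
    using \<rho> by (simp_all add: ready_def)
  have last: "fold (control.mod_step p) (concat (map encode_num [n])) ((S15, fl), \<rho>') =
      control.mod_step p Sep ((S15, fl), \<rho>')" if "\<And>r. \<rho>' r < p" for n \<rho>'
    using read_number [of \<rho>' p S15 n fl] that by (simp add: read_slot_def)
  show ?thesis
    unfolding encode_matrix_def mat_to_list_4 [OF C] list.map(2) [of nat] list.map(1) [of nat]
    by (simp only: read_numbers last read_slot_def slot_entry.simps next_slot.simps option.case
        option.distinct option.inject slot.distinct read_entry_less read_entry_other lt clear
        entry.distinct not_False_eq_True simp_thms read_matrix_def fold_simps entry_nat_def
        entry_def position.simps)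
qed

text \<open>Two entries of the same matrix are multiplied only with the earlier one in row order as
  the stored factor. The four such products listed are those that \<open>finish_matrix\<close>
  uses.\<close>

lemma read_matrix_simps:
  assumes "\<And>i. n i < p"
  shows "read_matrix p \<rho> n (Base (Cur e)) = n e"
    "read_matrix p \<rho> n (Base (Sum e)) = \<rho> (Base (Sum e))"
    "read_matrix p \<rho> n (Base First12) = \<rho> (Base First12)"
    "read_matrix p \<rho> n (Base First23) = \<rho> (Base First23)"
    "read_matrix p \<rho> n (Base First34) = \<rho> (Base First34)"
    "read_matrix p \<rho> n Lin1 = \<rho> Lin1" "read_matrix p \<rho> n Lin2 = \<rho> Lin2"
    "read_matrix p \<rho> n Lin = \<rho> Lin" "read_matrix p \<rho> n Mid = \<rho> Mid"
    "read_matrix p \<rho> n De1 = \<rho> De1" "read_matrix p \<rho> n De2 = \<rho> De2"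
    "read_matrix p \<rho> n Lhs = \<rho> Lhs"
    "read_matrix p \<rho> n (Prod i First12) = n i * \<rho> (Base First12) mod p"
    "read_matrix p \<rho> n (Prod i First34) = n i * \<rho> (Base First34) mod p"
    "read_matrix p \<rho> n (Prod i First23) = n i * \<rho> (Base First23) mod p"
    "read_matrix p \<rho> n (Prod i (Sum e)) = n i * \<rho> (Base (Sum e)) mod p"
    "read_matrix p \<rho> n (Prod E24 (Cur E12)) = n E24 * n E12 mod p"
    "read_matrix p \<rho> n (Prod E24 (Cur E13)) = n E24 * n E13 mod p"
    "read_matrix p \<rho> n (Prod E34 (Cur E13)) = n E34 * n E13 mod p"
    "read_matrix p \<rho> n (Prod E23 (Cur E14)) = n E23 * n E14 mod p"
  using assms
  by (cases e; simp add: read_matrix_def read_entry_def; cases i; simp)+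


definition entry_nat_sum :: "int mat list \<Rightarrow> entry \<Rightarrow> nat" where
  "entry_nat_sum Cs e = (\<Sum>C\<leftarrow>Cs. entry_nat C e)"

lemma entry_nat_less: "C \<in> carrier (UT 4 p) \<Longrightarrow> entry_nat C e < p"
  using entry_range [of C p e] by (simp add: entry_nat_def)

lemma finish_matrix_step:
  assumes p: "p > 1" and n: "\<And>i. n i < p" and \<rho>: "ready p \<rho>"
    and fl: "fl = (n1, n2, n3, ac, rk, fr)"
  defines "\<rho>' \<equiv> assign_mod p add_up (assign_mod p (finish_matrix fl) (read_matrix p \<rho> n))"
  shows "ready p \<rho>'"
    and "\<rho>' (Base (Sum e)) = (\<rho> (Base (Sum e)) + n e) mod p"
    and "\<rho>' (Base First12) = (if ac then \<rho> (Base First12) else n E12)"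
    and "\<rho>' (Base First34) = (if ac then \<rho> (Base First34) else n E34)"
    and "\<rho>' (Base First23) = (if n1 then \<rho> (Base First23) else n E23)"
    and "\<rho>' Lin1 = (if ac then \<rho> Lin1 + n E13 * \<rho> (Base First34)
      else n E34 * \<rho> (Base (Sum E13)) + n E34 * n E13) mod p"
    and "\<rho>' Lin2 = (if ac then \<rho> Lin2 + n E24 * \<rho> (Base First12)
      else n E12 * \<rho> (Base (Sum E24)) + n E24 * n E12) mod p"
    and "\<rho>' Mid = (if n1 then \<rho> Mid + n E14 * \<rho> (Base First23)
      else n E23 * \<rho> (Base (Sum E14)) + n E23 * n E14) mod p"
    and "\<rho>' De1 = (if n1 then \<rho> De1 else n E24 * n E13 mod p)"
    and "\<rho>' De2 = (if n2 then \<rho> De2 else n E24 * n E13 mod p)"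
    and "\<rho>' Lin = (\<rho>' Lin1 + \<rho>' Lin2) mod p"
    and "\<rho>' Lhs = (\<rho>' Mid + \<rho>' De2) mod p"
proof -
  have lt: "\<rho> r < p" for r using \<rho> by (simp add: ready_def)
  note simps = \<rho>'_def fl assign_mod_def keep_def read_matrix_simps [of n, OF n]
  show "ready p \<rho>'"
    using p by (auto simp: ready_def simps)
  show "\<rho>' (Base (Sum e)) = (\<rho> (Base (Sum e)) + n e) mod p"
    by (simp add: simps)
  show "\<rho>' (Base First12) = (if ac then \<rho> (Base First12) else n E12)"
    "\<rho>' (Base First34) = (if ac then \<rho> (Base First34) else n E34)"
    "\<rho>' (Base First23) = (if n1 then \<rho> (Base First23) else n E23)"
    "\<rho>' De1 = (if n1 then \<rho> De1 else n E24 * n E13 mod p)"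
    "\<rho>' De2 = (if n2 then \<rho> De2 else n E24 * n E13 mod p)"
    using lt n by (simp_all add: simps)
  show "\<rho>' Lin1 = (if ac then \<rho> Lin1 + n E13 * \<rho> (Base First34)
      else n E34 * \<rho> (Base (Sum E13)) + n E34 * n E13) mod p"
    "\<rho>' Lin2 = (if ac then \<rho> Lin2 + n E24 * \<rho> (Base First12)
      else n E12 * \<rho> (Base (Sum E24)) + n E24 * n E12) mod p"
    "\<rho>' Mid = (if n1 then \<rho> Mid + n E14 * \<rho> (Base First23)
      else n E23 * \<rho> (Base (Sum E14)) + n E23 * n E14) mod p"
    by (simp_all add: simps mod_simps)
  show "\<rho>' Lin = (\<rho>' Lin1 + \<rho>' Lin2) mod p" "\<rho>' Lhs = (\<rho>' Mid + \<rho>' De2) mod p"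
    by (simp_all add: simps mod_simps)
qed

lemma mod_step_matrix:
  assumes "C \<in> carrier (UT 4 p)" "ready p \<rho>"
  shows "fold (control.mod_step p) (encode_matrix C) ((S0, fl), \<rho>) =
    ((S0, finish_flags fl (\<lambda>e. entry_nat C e = 0)
       (entry_nat C E12 * \<rho> (Base First34) mod p = entry_nat C E34 * \<rho> (Base First12) mod p)),
     assign_mod p add_up (assign_mod p (finish_matrix fl) (read_matrix p \<rho> (entry_nat C))))"
  using fold_encode_matrix [OF UT_carrierD [OF assms(1)] assms(2), of fl]
  by (simp add: control.mod_step_def read_matrix_simps [where n = "entry_nat C", OF entry_nat_less [OF assms(1)]])

section \<open>Invariant of the run over the matrices\<close>

definition middle :: "int mat list \<Rightarrow> int mat list" where
  "middle Cs = filter (\<lambda>C. entry_nat C E23 \<noteq> 0) Cs"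

definition outer :: "int mat \<Rightarrow> bool" where
  "outer C \<longleftrightarrow> entry_nat C E12 \<noteq> 0 \<or> entry_nat C E34 \<noteq> 0"

definition free :: "int mat \<Rightarrow> bool" where
  "free C \<longleftrightarrow> outer C \<or> entry_nat C E23 = 0 \<and> (entry_nat C E13 \<noteq> 0 \<or> entry_nat C E24 \<noteq> 0)"

text \<open>\<open>First12\<close> and \<open>First34\<close> come from the first matrix \<open>J\<close> with a nonzero outer superdiagonal
  entry, and \<open>rk\<close> says that some matrix is not proportional to it.  \<open>De1\<close> and \<open>De2\<close> are meaningless
  until the first and second matrix with a nonzero middle entry have been read.\<close>

fun flags_correct :: "nat \<Rightarrow> int mat list \<Rightarrow> flags \<Rightarrow> (reg \<Rightarrow> nat) \<Rightarrow> bool" where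
  "flags_correct p Cs (n1, n2, n3, ac, rk, fr) \<rho> \<longleftrightarrow>
     (n1 \<longleftrightarrow> length (middle Cs) \<ge> 1) \<and> (n2 \<longleftrightarrow> length (middle Cs) \<ge> 2) \<and>
     (n3 \<longleftrightarrow> length (middle Cs) \<ge> 3) \<and>
     (ac \<longleftrightarrow> (\<exists>C \<in> set Cs. outer C)) \<and> (fr \<longleftrightarrow> (\<exists>C \<in> set Cs. free C)) \<and>
     (rk \<longleftrightarrow> (\<exists>C \<in> set Cs. entry_nat C E12 * \<rho> (Base First34) mod p \<noteq>
        entry_nat C E34 * \<rho> (Base First12) mod p))"

definition registers_correct :: "nat \<Rightarrow> int mat list \<Rightarrow> (reg \<Rightarrow> nat) \<Rightarrow> bool" where
  "registers_correct p Cs \<rho> \<longleftrightarrow> ready p \<rho> \<and>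
     (\<forall>e. \<rho> (Base (Sum e)) = entry_nat_sum Cs e mod p) \<and>
     ((\<exists>C \<in> set Cs. outer C) \<longrightarrow> (\<exists>J \<in> set Cs. outer J \<and>
        \<rho> (Base First12) = entry_nat J E12 \<and> \<rho> (Base First34) = entry_nat J E34)) \<and>
     ((\<forall>C \<in> set Cs. \<not> outer C) \<longrightarrow> \<rho> (Base First12) = 0 \<and> \<rho> (Base First34) = 0) \<and>
     \<rho> Lin1 = \<rho> (Base First34) * entry_nat_sum Cs E13 mod p \<and>
     \<rho> Lin2 = \<rho> (Base First12) * entry_nat_sum Cs E24 mod p \<and>
     \<rho> Lin = (\<rho> Lin1 + \<rho> Lin2) mod p \<and>
     \<rho> (Base First23) = (if middle Cs = [] then 0 else entry_nat (hd (middle Cs)) E23) \<and>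
     \<rho> Mid = \<rho> (Base First23) * entry_nat_sum Cs E14 mod p \<and>
     (\<forall>M Ns. middle Cs = M # Ns \<longrightarrow> \<rho> De1 = entry_nat M E24 * entry_nat M E13 mod p) \<and>
     (\<forall>M N Ns. middle Cs = M # N # Ns \<longrightarrow> \<rho> De2 = entry_nat N E24 * entry_nat N E13 mod p) \<and>
     \<rho> Lhs = (\<rho> Mid + \<rho> De2) mod p"

lemma run_matrices:
  assumes p: "p > 1" and "set Cs \<subseteq> carrier (UT 4 p)"
  shows "\<exists>fl \<rho>. fold (control.mod_step p) (concat (map encode_matrix Cs)) (initial, \<lambda>_. 0) = ((S0, fl), \<rho>) \<and>
    flags_correct p Cs fl \<rho> \<and> registers_correct p Cs \<rho>"
  using assms(2)
proof (induction Cs rule: rev_induct)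
  case Nil
  show ?case
    using p by (simp add: initial_def registers_correct_def ready_def entry_nat_sum_def middle_def)
next
  case (snoc C Cs)
  then obtain fl \<rho> where run:
      "fold (control.mod_step p) (concat (map encode_matrix Cs)) (initial, \<lambda>_. 0) = ((S0, fl), \<rho>)"
    and fc: "flags_correct p Cs fl \<rho>" and rc: "registers_correct p Cs \<rho>" by auto
  have C: "C \<in> carrier (UT 4 p)" using snoc.prems by simp
  have ready: "ready p \<rho>" using rc by (simp add: registers_correct_def)
  obtain n1 n2 n3 ac rk fr where fl: "fl = (n1, n2, n3, ac, rk, fr)" by (cases fl rule: prod_cases6)
  define \<rho>' where
    "\<rho>' = assign_mod p add_up (assign_mod p (finish_matrix fl) (read_matrix p \<rho> (entry_nat C)))"
  define fl' where "fl' = finish_flags fl (\<lambda>e. entry_nat C e = 0)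
       (entry_nat C E12 * \<rho> (Base First34) mod p = entry_nat C E34 * \<rho> (Base First12) mod p)"
  note step = finish_matrix_step [where n = "entry_nat C", OF p entry_nat_less [OF C] ready fl, folded \<rho>'_def]
  have run': "fold (control.mod_step p) (concat (map encode_matrix (Cs @ [C]))) (initial, \<lambda>_. 0) =
      ((S0, fl'), \<rho>')"
    using run mod_step_matrix [OF C ready, of fl] by (simp add: \<rho>'_def fl'_def)
  have sum: "entry_nat_sum (Cs @ [C]) e = entry_nat_sum Cs e + entry_nat C e" for e
    by (simp add: entry_nat_sum_def)
  have flag: "n1 \<longleftrightarrow> middle Cs \<noteq> []" "n2 \<longleftrightarrow> length (middle Cs) \<ge> 2" "n3 \<longleftrightarrow> length (middle Cs) \<ge> 3"
    "ac \<longleftrightarrow> (\<exists>C \<in> set Cs. outer C)" "fr \<longleftrightarrow> (\<exists>C \<in> set Cs. free C)"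
    "rk \<longleftrightarrow> (\<exists>C \<in> set Cs. entry_nat C E12 * \<rho> (Base First34) mod p \<noteq> entry_nat C E34 * \<rho> (Base First12) mod p)"
    using fc by (auto simp: fl Suc_le_eq)
  have mid: "middle (Cs @ [C]) = middle Cs @ (if entry_nat C E23 = 0 then [] else [C])"
    by (simp add: middle_def)
  have reg: "\<rho> (Base (Sum e)) = entry_nat_sum Cs e mod p"
    "ac \<Longrightarrow> \<exists>J \<in> set Cs. outer J \<and> \<rho> (Base First12) = entry_nat J E12 \<and> \<rho> (Base First34) = entry_nat J E34"
    "\<not> ac \<Longrightarrow> \<rho> (Base First12) = 0 \<and> \<rho> (Base First34) = 0"
    "\<rho> Lin1 = \<rho> (Base First34) * entry_nat_sum Cs E13 mod p"
    "\<rho> Lin2 = \<rho> (Base First12) * entry_nat_sum Cs E24 mod p"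
    "\<rho> (Base First23) = (if n1 then entry_nat (hd (middle Cs)) E23 else 0)"
    "\<rho> Mid = \<rho> (Base First23) * entry_nat_sum Cs E14 mod p"
    "middle Cs = M # Ns \<Longrightarrow> \<rho> De1 = entry_nat M E24 * entry_nat M E13 mod p"
    "middle Cs = M # N # Ns \<Longrightarrow> \<rho> De2 = entry_nat N E24 * entry_nat N E13 mod p" for e M N Ns
    using rc flag by (auto simp: registers_correct_def)
  have "flags_correct p (Cs @ [C]) fl' \<rho>'"
  proof -
    have rk: "(rk \<or> entry_nat C E12 * \<rho> (Base First34) mod p \<noteq> entry_nat C E34 * \<rho> (Base First12) mod p) \<longleftrightarrow>
      (\<exists>B \<in> set (Cs @ [C]). entry_nat B E12 * \<rho>' (Base First34) mod p \<noteq> entry_nat B E34 * \<rho>' (Base First12) mod p)"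
    proof (cases ac)
      case True
      then have "\<rho>' (Base First12) = \<rho> (Base First12)" "\<rho>' (Base First34) = \<rho> (Base First34)"
        by (simp_all add: step(3,4))
      then show ?thesis unfolding flag(6) by (simp only: set_append bex_Un list.set bex_simps) blast
    next
      case False
      \<comment> \<open>Earlier matrices have zero outer entries and are trivially proportional to
        \<open>C\<close>, the new reference candidate.\<close>
      then have z: "entry_nat B E12 = 0" "entry_nat B E34 = 0" if "B \<in> set Cs" for B
        using that flag(4) by (auto simp: outer_def)
      have "\<not> rk"
        unfolding flag(6) using z by simp
      moreover have "entry_nat C E12 * \<rho> (Base First34) mod p = entry_nat C E34 * \<rho> (Base First12) mod p"
        using reg(3) [OF False] by simp
      moreover have "entry_nat B E12 * \<rho>' (Base First34) mod p = entry_nat B E34 * \<rho>' (Base First12) mod p"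
        if "B \<in> set (Cs @ [C])" for B
      proof (cases "B = C")
        case True
        then show ?thesis using False by (simp add: step(3,4) mult.commute)
      next
        case False
        then have "B \<in> set Cs" using that by simp
        then show ?thesis by (simp add: z)
      qed
      ultimately show ?thesis by blast
    qed
    have "fl' = (n1 \<or> entry_nat C E23 \<noteq> 0, n2 \<or> n1 \<and> entry_nat C E23 \<noteq> 0, n3 \<or> n2 \<and> entry_nat C E23 \<noteq> 0,
        ac \<or> outer C,
        rk \<or> entry_nat C E12 * \<rho> (Base First34) mod p \<noteq> entry_nat C E34 * \<rho> (Base First12) mod p, fr \<or> free C)"
      by (auto simp: fl'_def fl outer_def free_def)
    moreover have "n1 \<or> entry_nat C E23 \<noteq> 0 \<longleftrightarrow> length (middle (Cs @ [C])) \<ge> 1"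
      using flag(1) by (simp add: mid Suc_le_eq)
    moreover have "n2 \<or> n1 \<and> entry_nat C E23 \<noteq> 0 \<longleftrightarrow> length (middle (Cs @ [C])) \<ge> 2"
      using flag(1,2) by (cases "middle Cs") (auto simp: mid)
    moreover have "n3 \<or> n2 \<and> entry_nat C E23 \<noteq> 0 \<longleftrightarrow> length (middle (Cs @ [C])) \<ge> 3"
      using flag(2,3) by (simp add: mid) linarith
    moreover have "ac \<or> outer C \<longleftrightarrow> (\<exists>B \<in> set (Cs @ [C]). outer B)"
      using flag(4) by auto
    moreover have "fr \<or> free C \<longleftrightarrow> (\<exists>B \<in> set (Cs @ [C]). free B)"
      using flag(5) by auto
    ultimately show ?thesis
      using rk by (simp only: flags_correct.simps simp_thms)
  qed
  moreover have "registers_correct p (Cs @ [C]) \<rho>'"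
  proof -
    have "\<forall>e. \<rho>' (Base (Sum e)) = entry_nat_sum (Cs @ [C]) e mod p"
      by (simp add: step(2) reg(1) sum mod_simps)
    moreover have "\<exists>J \<in> set (Cs @ [C]). outer J \<and> \<rho>' (Base First12) = entry_nat J E12 \<and>
        \<rho>' (Base First34) = entry_nat J E34" if "\<exists>B \<in> set (Cs @ [C]). outer B"
    proof (cases ac)
      case True
      then show ?thesis using reg(2) by (auto simp: step(3,4))
    next
      case False
      then have "outer C" using that flag(4) by auto
      then show ?thesis using False by (intro bexI [of _ C]) (auto simp: step(3,4))
    qed
    moreover have "\<rho>' (Base First12) = 0 \<and> \<rho>' (Base First34) = 0" if "\<forall>B \<in> set (Cs @ [C]). \<not> outer B"
      using that flag(4) by (auto simp: step(3,4) outer_def)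
    moreover have "\<rho>' Lin1 = \<rho>' (Base First34) * entry_nat_sum (Cs @ [C]) E13 mod p"
      by (simp add: step(4,6) reg(1,4) sum mod_simps mod_add_mult_mod algebra_simps)
    moreover have "\<rho>' Lin2 = \<rho>' (Base First12) * entry_nat_sum (Cs @ [C]) E24 mod p"
      by (simp add: step(3,7) reg(1,5) sum mod_simps mod_add_mult_mod algebra_simps)
    moreover have "\<rho>' (Base First23) = (if middle (Cs @ [C]) = [] then 0 else entry_nat (hd (middle (Cs @ [C]))) E23)"
      using flag(1) by (auto simp: step(5) reg(6) mid)
    moreover have "\<rho>' Mid = \<rho>' (Base First23) * entry_nat_sum (Cs @ [C]) E14 mod p"
      by (simp add: step(5,8) reg(1,7) sum mod_simps mod_add_mult_mod algebra_simps)
    moreover have "\<rho>' De1 = entry_nat M E24 * entry_nat M E13 mod p" if "middle (Cs @ [C]) = M # Ns" for M Ns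
      using that flag(1) reg(8) by (cases "middle Cs") (auto simp: step(9) mid split: if_splits)
    moreover have "\<rho>' De2 = entry_nat N E24 * entry_nat N E13 mod p" if "middle (Cs @ [C]) = M # N # Ns" for M N Ns
    proof (cases n2)
      case True
      then obtain M' N' Ns' where "middle Cs = M' # N' # Ns'"
        using flag(2) by (cases "middle Cs"; cases "tl (middle Cs)") auto
      then show ?thesis using that True reg(9) by (auto simp: step(10) mid)
    next
      case False
      \<comment> \<open>Without \<open>n2\<close> at most one matrix was in the list, so a second
        one must be the matrix just read.\<close>
      then have "N = C"
        using that flag(2) by (cases "middle Cs"; cases "tl (middle Cs)") (auto simp: mid split: if_splits)
      then show ?thesis using False by (simp add: step(10))
    qed
    ultimately show ?thesis
      unfolding registers_correct_def using step(1,11,12) by blast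
  qed
  ultimately show ?case using run' by blast
qed

section \<open>The final test decides solvability\<close>

lemma mod_eq_iff_int_dvd: "a mod p = b mod p \<longleftrightarrow> int p dvd int a - int b" for a b p :: nat
proof -
  have "a mod p = b mod p \<longleftrightarrow> int a mod int p = int b mod int p"
    by (metis of_nat_eq_iff zmod_int)
  then show ?thesis by (simp add: mod_eq_dvd_iff)
qed

lemma dvd_entry_sum_filter:
  "P dvd entry_sum Cs e - entry_sum (filter (\<lambda>C. \<not> P dvd entry C e) Cs) e"
  by (induction Cs) (auto simp: algebra_simps dvd_add_right_iff)

lemma final_iff:
  assumes p: "prime p" and Cs: "set Cs \<subseteq> carrier (UT 4 p)"
    and fc: "flags_correct p Cs fl \<rho>" and rc: "registers_correct p Cs \<rho>"
  shows "final (S0, fl) (\<lambda>x y. reg_val \<rho> x = reg_val \<rho> y) \<longleftrightarrow> spherical_solvable (p, Cs)"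
proof -
  let ?P = "int p"
  have prime: "prime ?P" using p by simp
  have p1: "p > 1" using p by (rule prime_gt_1_nat)
  obtain n1 n2 n3 ac rk fr where fl: "fl = (n1, n2, n3, ac, rk, fr)" by (cases fl rule: prod_cases6)
  have int_entry_nat: "int (entry_nat C e) = entry C e" if "C \<in> set Cs" for C e
    using entry_range [of C p e] that Cs by (auto simp: entry_nat_def)
  have entry_nat_0: "entry_nat C e = 0 \<longleftrightarrow> ?P dvd entry C e" if "C \<in> set Cs" for C e
  proof -
    have "0 \<le> entry C e" "entry C e < ?P"
      using entry_range [of C p e] that Cs by auto
    then have "?P dvd entry C e \<longleftrightarrow> entry C e = 0"
      by (metis dvd_0_right order_le_less zdvd_not_zless)
    then show ?thesis
      using int_entry_nat [OF that, of e] by linarith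
  qed
  have int_sum: "int (entry_nat_sum Cs e) = entry_sum Cs e" for e
    unfolding entry_nat_sum_def entry_sum_def using int_entry_nat
    by (induction Cs) simp_all
  have sum_0: "entry_nat_sum Cs e mod p = 0 \<longleftrightarrow> ?P dvd entry_sum Cs e" for e
    using mod_eq_iff_int_dvd [of "entry_nat_sum Cs e" p 0] by (simp add: int_sum)
  have middle: "middle Cs = active ?P Cs"
    unfolding middle_def by (rule filter_cong) (simp_all add: entry_nat_0)
  have outer: "outer C \<longleftrightarrow> \<not> (?P dvd entry C E12 \<and> ?P dvd entry C E34)" if "C \<in> set Cs" for C
    using that by (simp add: outer_def entry_nat_0)
  have free: "free C \<longleftrightarrow> central_free ?P C" if "C \<in> set Cs" for C
    using that by (simp add: free_def central_free_def outer entry_nat_0) blast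
  have flag: "n1 \<longleftrightarrow> length (active ?P Cs) \<ge> 1" "n3 \<longleftrightarrow> length (active ?P Cs) \<ge> 3"
    "ac \<longleftrightarrow> (\<exists>C \<in> set Cs. outer C)" "fr \<longleftrightarrow> (\<exists>C \<in> set Cs. central_free ?P C)"
    "rk \<longleftrightarrow> (\<exists>C \<in> set Cs. entry_nat C E12 * \<rho> (Base First34) mod p \<noteq> entry_nat C E34 * \<rho> (Base First12) mod p)"
    using fc free by (simp_all add: fl middle)
  have Sum: "\<rho> (Base (Sum e)) = 0 \<longleftrightarrow> ?P dvd entry_sum Cs e" for e
    using rc by (simp add: registers_correct_def flip: sum_0)
  have regs: "ac \<Longrightarrow> \<exists>J \<in> set Cs. outer J \<and> \<rho> (Base First12) = entry_nat J E12 \<and> \<rho> (Base First34) = entry_nat J E34"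
    "\<rho> Lin = (\<rho> (Base First34) * entry_nat_sum Cs E13 + \<rho> (Base First12) * entry_nat_sum Cs E24) mod p"
    "active ?P Cs = M # Ns \<Longrightarrow> \<rho> De1 = entry_nat M E24 * entry_nat M E13 mod p"
    "active ?P Cs = M # N # Ns \<Longrightarrow>
      \<rho> Lhs = (entry_nat M E23 * entry_nat_sum Cs E14 + entry_nat N E24 * entry_nat N E13) mod p" for M N Ns
    using rc by (auto simp: registers_correct_def flag middle mod_simps)
  define R where "R \<longleftrightarrow> (if n1 then fr \<or> n3 \<or> \<rho> Lhs = \<rho> De1
     else (if ac then rk \<or> \<rho> Lin = 0 else ?P dvd entry_sum Cs E13 \<and> ?P dvd entry_sum Cs E24) \<and>
       (fr \<or> ?P dvd entry_sum Cs E14))"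
  \<comment> \<open>The vanishing sum excludes a single active factor and makes the middle entries
    of two active factors opposite. If the sum does not vanish, \<open>final\<close> and solvability
    both fail.\<close>
  have "prod_to ?P Cs 0 0 0 \<longleftrightarrow> R" if E23: "?P dvd entry_sum Cs E23"
  proof (cases n1)
    case True
    then have ex: "\<exists>C \<in> set Cs. \<not> ?P dvd entry C E23"
      unfolding flag(1) by (simp add: Suc_le_eq filter_empty_conv)
    show ?thesis
    proof (cases "fr \<or> n3")
      case True
      then have "prod_to ?P Cs 0 0 0"
        using prod_to_middle_central [OF prime ex] prod_to_active_three [OF prime, of Cs 0] flag(2,4)
        by blast
      then show ?thesis using True \<open>n1\<close> by (auto simp: R_def)
    next
      case False
      have rigid: "\<forall>C \<in> set Cs. \<not> central_free ?P C"
        using False flag(4) by simp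
      have sum: "?P dvd entry_sum (active ?P Cs) E23"
        using dvd_entry_sum_filter [of ?P Cs E23] E23 dvd_diff [OF E23] by fastforce
      have len: "length (active ?P Cs) \<ge> 1" "length (active ?P Cs) < 3"
        using False \<open>n1\<close> flag(1,2) by auto
      have "length (active ?P Cs) \<noteq> 1"
      proof
        assume "length (active ?P Cs) = 1"
        then obtain M where M: "active ?P Cs = [M]"
          by (auto simp: length_Suc_conv)
        then have "\<not> ?P dvd entry M E23" by (metis filter_eq_ConsD)
        then show False using sum M by simp
      qed
      with len have "length (active ?P Cs) = 2" by simp
      then obtain M N where MN: "active ?P Cs = [M, N]"
        by (auto simp: length_Suc_conv numeral_2_eq_2)
      then have "set [M, N] \<subseteq> set Cs"
        by (metis filter_is_subset)
      then have in_Cs: "M \<in> set Cs" "N \<in> set Cs" by auto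
      have "prod_to ?P Cs 0 0 0 \<longleftrightarrow> ?P dvd entry M E23 * (0 - entry_sum Cs E14) +
          entry M E13 * entry M E24 - entry N E13 * entry N E24"
        by (rule prod_to_active_two [OF prime rigid MN]) (use sum MN in simp)
      \<comment> \<open>Reversing the sign leaves only additions on the side of \<open>Lhs\<close>,
        as assignments cannot subtract registers.\<close>
      also have "\<dots> \<longleftrightarrow> ?P dvd (entry M E23 * entry_sum Cs E14 + entry N E24 * entry N E13)
          - entry M E24 * entry M E13"
        by (subst dvd_minus_iff [symmetric]) (simp add: algebra_simps)
      also have "\<dots> \<longleftrightarrow> \<rho> Lhs = \<rho> De1"
        unfolding regs(3,4) [OF MN] mod_eq_iff_int_dvd by (simp add: int_entry_nat in_Cs int_sum)
      finally show ?thesis using False \<open>n1\<close> by (simp add: R_def)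
    qed
  next
    case False
    then have b: "\<forall>C \<in> set Cs. ?P dvd entry C E23"
      unfolding flag(1) by (simp add: filter_empty_conv Suc_le_eq)
    show ?thesis
    proof (cases ac)
      case True
      then obtain J where J: "J \<in> set Cs" "outer J" "\<rho> (Base First12) = entry_nat J E12"
        "\<rho> (Base First34) = entry_nat J E34" using regs(1) by blast
      have nz: "\<not> (?P dvd entry J E12 \<and> ?P dvd entry J E34)"
        using J(1,2) outer by simp
      then have fr unfolding flag(4) central_free_def using J(1) by blast
      have rk: "rk \<longleftrightarrow> (\<exists>K \<in> set Cs. \<not> ?P dvd entry J E12 * entry K E34 - entry K E12 * entry J E34)"
        unfolding flag(5) J(3,4) mod_eq_iff_int_dvd
        by (rule bex_cong [OF refl], subst dvd_diff_commute) (simp add: int_entry_nat J(1) mult.commute)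
      show ?thesis
      proof (cases rk)
        case True
        then show ?thesis
          using prod_to_rank_two [OF prime b J(1)] rk \<open>fr\<close> \<open>ac\<close> \<open>\<not> n1\<close> by (auto simp: R_def)
      next
        case False
        then have "prod_to ?P Cs 0 0 0 \<longleftrightarrow>
            ?P dvd entry J E34 * entry_sum Cs E13 + entry J E12 * entry_sum Cs E24"
          using rk by (intro prod_to_rank_one [OF prime b J(1) nz]) blast
        also have "\<dots> \<longleftrightarrow> \<rho> Lin = 0"
          unfolding regs(2) J(3,4)
          by (simp add: int_entry_nat J(1) int_sum mod_eq_0_iff_dvd flip: int_dvd_int_iff)
        finally show ?thesis using False \<open>fr\<close> \<open>ac\<close> \<open>\<not> n1\<close> by (simp add: R_def)
      qed
    next
      case False
      then have "\<forall>C \<in> set Cs. ?P dvd entry C E12 \<and> ?P dvd entry C E23 \<and> ?P dvd entry C E34"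
        using b outer flag(3) by blast
      then show ?thesis
        using prod_to_no_superdiagonal [OF prime] False \<open>\<not> n1\<close> flag(4) by (simp add: R_def)
    qed
  qed
  then show ?thesis
    unfolding spherical_solvable_iff [OF p1 Cs] by (auto simp: fl Sum R_def)
qed

lemma encode_instance_eq:
  "encode_instance (p, Cs) = map Bit (binary p) @ Sep # concat (map encode_matrix Cs)"
proof -
  have "concat (map encode_num (map nat (concat (concat (map mat_to_list Cs))))) =
      concat (map encode_matrix Cs)"
    by (induction Cs) (simp_all add: encode_matrix_def)
  then show ?thesis
    by (simp add: encode_instance_def encode_num_def)
qed

theorem theorem46:
  shows "in_P instances encode_instance spherical_solvable"
proof -
  let ?L = "accepted control.ctl_step Load"
  have "encode_instance x \<in> ?L \<longleftrightarrow> spherical_solvable x" if inst: "x \<in> instances" for x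
  proof -
    obtain p Cs where x: "x = (p, Cs)" by force
    have p: "prime p" and Cs: "set Cs \<subseteq> carrier (UT 4 p)"
      using inst by (auto simp: instances_def x)
    obtain fl \<rho> where run:
        "fold (control.mod_step p) (concat (map encode_matrix Cs)) (initial, \<lambda>_. 0) = ((S0, fl), \<rho>)"
      and correct: "flags_correct p Cs fl \<rho>" "registers_correct p Cs \<rho>"
      using run_matrices [OF prime_gt_1_nat [OF p] Cs] by blast
    show ?thesis
      using control.accepted_streamer_mod [of "binary p" "concat (map encode_matrix Cs)"]
        run final_iff [OF p Cs correct] prime_gt_0_nat [OF p]
      by (simp add: x encode_instance_eq bits_val_binary)
  qed
  moreover have "?L \<in> class_P"
    by (rule control.accepted_streamer_in_class_P)
  ultimately show ?thesis
    unfolding in_P_def by blast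
qed

end
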